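(* Assume that $F$ is twice continuously differentiable over $\mathbb{R}^n$. Let $\{x_{j_k}\}$ be a refining linked sequence produced by the Front Descent algorithm (described in the context) with $\sigma_k=0$ for all $k$, $\alpha_0=1$, $\gamma\in(0,\frac12)$ and with tentative directions $v_D(x_{j_k})=v_N(x_{j_k})$, where $$v_N(x_{j_k})=\operatorname{argmin}_{d\in\mathbb{R}^n}\max_{h=1,\ldots,m}\nabla f_h(x_{j_k})^\top d+\frac12d^\top B_h(x_{j_k})d,\qquad B_h(x_{j_k})=\nabla^2f_h(x_{j_k})+\eta_h^kI\quad\text{for all }h=1,\ldots,m,$$ with $$\eta_h^k=\begin{cases}-\lambda_{\min}(\nabla^2f_h(x_{j_k}))+\kappa,&\text{if }\lambda_{\min}(\nabla^2f_h(x_{j_k}))\le0,\\0,&\text{otherwise},\end{cases}$$ and $\kappa>0$. Let $\bar x$ be a local Pareto optimal point such that $\nabla^2f_h(\bar x)$ is positive definite for all $h=1,\ldots,m$. Assume that $$\Gamma_1\le\frac{\omega^3}{2}\,\frac{\min_{h=1,\ldots,m}\lambda_{\min}(\nabla^2f_h(\bar x))}{\max_{h=1,\ldots,m}\lambda_{\max}^2(\nabla^2f_h(\bar x))},\qquad\Gamma_2\ge\frac1{\omega\min_{h=1,\ldots,m}\lambda_{\min}(\nabla^2f_h(\bar x))},$$ with $\omega\in(0,1)$. Then there exist a neighborhood $\mathcal{N}(\bar x)$ of $\bar x$ and $0<\rho\le r$ such that, if $x_{j_{\bar k}}\in\mathcal{B}(\bar x,\rho)\subsetneq\mathcal{N}(\bar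 x)$ for some $\bar k$ such that $x_{j_{k+1}}=z_{j_k}^k$ for all $k\ge\bar k$, the following properties hold for all $k\ge\bar k$: (i) $\eta_h^k=0$ for all $h=1,\ldots,m$, i.e., $v_N(x_{j_k})$ is the Newton direction at $x_{j_k}$; (ii) $d_{j_k}=v_N(x_{j_k})$, i.e., $v_N(x_{j_k})$ satisfies $\mathcal{D}(x_{j_k},v_N(x_{j_k}))\le-\Gamma_1\|v(x_{j_k})\|^2$ and $\|v_N(x_{j_k})\|\le\Gamma_2\|v(x_{j_k})\|$; (iii) $\alpha_{j_k}^k=1$, i.e., no backtracking is needed in the Armijo-type line search of the refinement step; (iv) $x_{j_k}\in\mathcal{B}(x_{j_{\bar k}},r)\subsetneq\mathcal{N}(\bar x)$. Furthermore, the sequence $\{x_{j_k}\}$ converges superlinearly to a local Pareto optimal point $x^\star\in\mathcal{B}(x_{j_{\bar k}},r)$. If $\nabla^2f_h(\cdot)$ are additionally Lipschitz continuous in $\mathcal{N}(\bar x)$ for all $h=1,\ldots,m$, the convergence is quadratic.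
   Context: Setting. $F=(f_1,\ldots,f_m)^\top:\mathbb{R}^n\to\mathbb{R}^m$ is continuously differentiable. For $u,w\in\mathbb{R}^m$: $u\le w$ means $u_i\le w_i$ for all $i$; $u<w$ means $u_i<w_i$ for all $i$; $u\lneqq w$ means $u\le w$ and $u\ne w$. A point $y$ is dominated by $x$ if $F(x)\lneqq F(y)$. A set of points is mutually nondominated if none of its points is dominated by another one. A point $\bar x$ is local Pareto optimal if it has a neighborhood containing no $y$ with $F(y)\lneqq F(\bar x)$. $\mathbf{1}\in\mathbb{R}^m$ is the all-ones vector; $I$ as a matrix is the identity; $\lambda_{\min},\lambda_{\max}$ are minimum and maximum eigenvalues; $\mathcal{B}(x,r)$ is the Euclidean ball with center $x$ and radius $r$. For $x,d\in\mathbb{R}^n$ let $\mathcal{D}(x,d)=\max_{j=1,\ldots,m}\nabla f_j(x)^\top d$. For nonempty $I\subseteq\{1,\ldots,m\}$ let $\theta^I(x)=\min_{d\in\mathbb{R}^n}\max_{j\in I}\nabla f_j(x)^\top d+\frac12\|d\|^2$ and let $v^I(x)$ be the unique minimizer; $\theta$ and $v$ denote $\theta^I$ and $v^I$ for $I=\{1,\ldots,m\}$. A common descent direction at $x$ is a direction that is a descent direction at $x$ for every $f_j$. The Newton direction at $x$ is the minimizer of $\max_h\nabla f_h(x)^\top d+\frac12d^\top\nabla^2f_h(x)d$ over $d\in\mathbb{R}^n$. Front Descent algorithm. Input: a nonempty finite set $X^0$ of mutually nondominated points; $\alpha_0>0$, $\delta\in(0,1)$, $\gamma\in(0,1)$,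 $\Gamma_1>0$, $\Gamma_2>0$, a sequence $\{\sigma_k\}\subseteq\mathbb{R}_+$ (nonnegative reals). The algorithm is run without stopping, producing an infinite sequence $\{X^k\}$. At iteration $k=0,1,\ldots$: set $\hat X^k=X^k$; then, sequentially for all $x_c\in X^k$, if $x_c\in\hat X^k$ at that moment, process $x_c$ as follows. (1) Refinement. If $\theta(x_c)<-\sigma_k$: compute a common descent direction $v_D(x_c)$; if both $\mathcal{D}(x_c,v_D(x_c))\le-\Gamma_1\|v(x_c)\|^2$ and $\|v_D(x_c)\|\le\Gamma_2\|v(x_c)\|$, set $d_c=v_D(x_c)$, otherwise set $d_c=v(x_c)$; set $\alpha_c^k=\max_{h\in\mathbb{N}}\{\alpha_0\delta^h\mid F(x_c+\alpha_0\delta^hd_c)\le F(x_c)+\mathbf{1}\gamma\alpha_0\delta^h\mathcal{D}(x_c,d_c)\}$. Otherwise (if $\theta(x_c)\ge-\sigma_k$) set $d_c=v(x_c)$, $\alpha_c^k=0$. In both cases set $z_c^k=x_c+\alpha_c^kd_c$ and update $\hat X^k\leftarrow\hat X^k\setminus\{y\in\hat X^k\mid F(z_c^k)\lneqq F(y)\}\cup\{z_c^k\}$. (2) Exploration. For every nonempty proper subset $I\subsetneq\{1,\ldots,m\}$ with $\theta^I(z_c^k)<0$: if $z_c^k\in\hat X^k$ at that moment, set $\alpha_c^I=\max_{h\in\mathbb{N}}\{\alpha_0\delta^h\mid\forall y\in\hat X^k\ \exists j:\ f_j(z_c^k+\alpha_0\delta^hv^I(z_c^k))<f_j(y)\}$,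 let $w=z_c^k+\alpha_c^Iv^I(z_c^k)$ and update $\hat X^k\leftarrow\hat X^k\setminus\{y\in\hat X^k\mid F(w)\lneqq F(y)\}\cup\{w\}$. After all points have been considered, set $X^{k+1}=\hat X^k$. Linked sequence. A sequence $\{x_{j_k}\}$ such that, for every $k=1,2,\ldots$, the point $x_{j_k}\in X^k$ is generated at iteration $k-1$ of the algorithm (as the refinement point $z$ or as one of the exploration points $w$) while processing the point $x_{j_{k-1}}\in X^{k-1}$. It is a refining linked sequence if there exists $\bar k$ such that, for all $k>\bar k$, $x_{j_k}=z_{j_{k-1}}^{k-1}$. Here $d_{j_k}$, $\alpha_{j_k}^k$, $z_{j_k}^k$ denote the quantities $d_c$, $\alpha_c^k$, $z_c^k$ of the refinement step at iteration $k$ when processing $x_c=x_{j_k}$.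
   Formalization: Item (iii), the unit step size, is asserted only for those k with θ(x_{j_k})<0, i.e. when the line search is executed; if θ(x_{j_k})=0 the algorithm with σ_k=0 sets the step size to 0, so the unconditional claim fails. *)

theory Defs
  imports "HOL-Analysis.Analysis" "HOL-Library.Landau_Symbols"
begin

section \<open>Calculus and linear algebra\<close>

definition gradient :: "(real^'n \<Rightarrow> real) \<Rightarrow> real^'n \<Rightarrow> real^'n" where
  "gradient f x = (THE g. GDERIV f x :> g)"

definition hessian :: "(real^'n \<Rightarrow> real) \<Rightarrow> real^'n \<Rightarrow> real^'n^'n" where
  "hessian f x = jacobian (gradient f) (at x)"

definition twice_continuously_differentiable :: "(real^'n \<Rightarrow> real) \<Rightarrow> bool" where
  "twice_continuously_differentiable f \<longleftrightarrow>
     (\<forall>x. f differentiable (at x)) \<and> (\<forall>x. gradient f differentiable (at x)) \<and>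
     continuous_on UNIV (hessian f)"

definition eigenvalues :: "real^'n^'n \<Rightarrow> real set" where
  "eigenvalues A = {c. \<exists>v. v \<noteq> 0 \<and> A *v v = c *\<^sub>R v}"

(* Only applied to symmetric matrices, whose set of (real) eigenvalues is finite and nonempty. *)

definition lambda_min :: "real^'n^'n \<Rightarrow> real" where
  "lambda_min A = Min (eigenvalues A)"

definition lambda_max :: "real^'n^'n \<Rightarrow> real" where
  "lambda_max A = Max (eigenvalues A)"

definition positive_definite :: "real^'n^'n \<Rightarrow> bool" where
  "positive_definite A \<longleftrightarrow> (\<forall>v. v \<noteq> 0 \<longrightarrow> v \<bullet> (A *v v) > 0)"

definition the_minimizer :: "('a \<Rightarrow> real) \<Rightarrow> 'a" where
  "the_minimizer \<phi> = (THE d. is_arg_min \<phi> (\<lambda>_. True) d)"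

(* Landau symbols rather than quotients of consecutive errors: an iterate that coincides with
   the limit is then unproblematic. *)

definition converges_superlinearly :: "(nat \<Rightarrow> 'a::metric_space) \<Rightarrow> 'a \<Rightarrow> bool" where
  "converges_superlinearly x l \<longleftrightarrow>
     x \<longlonglongrightarrow> l \<and> (\<lambda>k. dist (x (Suc k)) l) \<in> o(\<lambda>k. dist (x k) l)"

definition converges_quadratically :: "(nat \<Rightarrow> 'a::metric_space) \<Rightarrow> 'a \<Rightarrow> bool" where
  "converges_quadratically x l \<longleftrightarrow>
     x \<longlonglongrightarrow> l \<and> (\<lambda>k. dist (x (Suc k)) l) \<in> O(\<lambda>k. (dist (x k) l)\<^sup>2)"

section \<open>Multiobjective optimization\<close>

definition dominates :: "(real^'n \<Rightarrow> real^'m) \<Rightarrow> real^'n \<Rightarrow> real^'n \<Rightarrow> bool" where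
  "dominates F x y \<longleftrightarrow> F x \<le> F y \<and> F x \<noteq> F y"

definition mutually_nondominated :: "(real^'n \<Rightarrow> real^'m) \<Rightarrow> (real^'n) set \<Rightarrow> bool" where
  "mutually_nondominated F X \<longleftrightarrow> (\<forall>x\<in>X. \<forall>y\<in>X. \<not> dominates F x y)"

definition local_Pareto_optimal :: "(real^'n \<Rightarrow> real^'m) \<Rightarrow> real^'n \<Rightarrow> bool" where
  "local_Pareto_optimal F x \<longleftrightarrow> (\<exists>U. open U \<and> x \<in> U \<and> (\<forall>y\<in>U. \<not> dominates F y x))"

definition grad :: "(real^'n \<Rightarrow> real^'m) \<Rightarrow> 'm \<Rightarrow> real^'n \<Rightarrow> real^'n" where
  "grad F j = gradient (\<lambda>y. F y $ j)"

definition hess :: "(real^'n \<Rightarrow> real^'m) \<Rightarrow> 'm \<Rightarrow> real^'n \<Rightarrow> real^'n^'n" where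
  "hess F j = hessian (\<lambda>y. F y $ j)"

definition max_slope :: "(real^'n \<Rightarrow> real^'m) \<Rightarrow> real^'n \<Rightarrow> real^'n \<Rightarrow> real" where
  "max_slope F x d = (MAX j. grad F j x \<bullet> d)"

definition descent_model ::
    "(real^'n \<Rightarrow> real^'m) \<Rightarrow> 'm set \<Rightarrow> real^'n \<Rightarrow> real^'n \<Rightarrow> real" where
  "descent_model F I x d = (MAX j\<in>I. grad F j x \<bullet> d) + (1/2) * (norm d)\<^sup>2"

(* For nonempty I the model is strongly convex, so its minimizer exists and is unique. *)

definition steepest_direction :: "(real^'n \<Rightarrow> real^'m) \<Rightarrow> 'm set \<Rightarrow> real^'n \<Rightarrow> real^'n" where
  "steepest_direction F I x = the_minimizer (descent_model F I x)"

definition theta :: "(real^'n \<Rightarrow> real^'m) \<Rightarrow> 'm set \<Rightarrow> real^'n \<Rightarrow> real" where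
  "theta F I x = descent_model F I x (steepest_direction F I x)"

definition common_descent_direction ::
    "(real^'n \<Rightarrow> real^'m) \<Rightarrow> real^'n \<Rightarrow> real^'n \<Rightarrow> bool" where
  "common_descent_direction F x d \<longleftrightarrow>
     (\<forall>j. \<exists>T>0. \<forall>t. 0 < t \<and> t \<le> T \<longrightarrow> F (x + t *\<^sub>R d) $ j < F x $ j)"

definition quadratic_model ::
    "(real^'n \<Rightarrow> real^'m) \<Rightarrow> ('m \<Rightarrow> real^'n^'n) \<Rightarrow> real^'n \<Rightarrow> real^'n \<Rightarrow> real" where
  "quadratic_model F B x d = (MAX h. grad F h x \<bullet> d + (1/2) * (d \<bullet> (B h *v d)))"

definition newton_direction :: "(real^'n \<Rightarrow> real^'m) \<Rightarrow> real^'n \<Rightarrow> real^'n" where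
  "newton_direction F x = the_minimizer (quadratic_model F (\<lambda>h. hess F h x) x)"

definition hessian_shift :: "real \<Rightarrow> real^'n^'n \<Rightarrow> real" where
  "hessian_shift \<kappa> A = (if lambda_min A \<le> 0 then - lambda_min A + \<kappa> else 0)"

(* mat c is the matrix c I. *)

definition modified_newton_direction ::
    "real \<Rightarrow> (real^'n \<Rightarrow> real^'m) \<Rightarrow> real^'n \<Rightarrow> real^'n" where
  "modified_newton_direction \<kappa> F x =
     the_minimizer
       (quadratic_model F (\<lambda>h. hess F h x + mat (hessian_shift \<kappa> (hess F h x))) x)"

section \<open>The Front Descent algorithm\<close>

record fd_params =
  fd_alpha0 :: real
  fd_delta :: real
  fd_gamma :: real
  fd_Gamma1 :: real
  fd_Gamma2 :: real
  fd_sigma :: "nat \<Rightarrow> real"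

definition valid_params :: "fd_params \<Rightarrow> bool" where
  "valid_params P \<longleftrightarrow>
     fd_alpha0 P > 0 \<and> 0 < fd_delta P \<and> fd_delta P < 1 \<and> 0 < fd_gamma P \<and> fd_gamma P < 1 \<and>
     fd_Gamma1 P > 0 \<and> fd_Gamma2 P > 0 \<and> (\<forall>k. fd_sigma P k \<ge> 0)"

definition update_front ::
    "(real^'n \<Rightarrow> real^'m) \<Rightarrow> real^'n \<Rightarrow> (real^'n) set \<Rightarrow> (real^'n) set" where
  "update_front F z X = (X - {y \<in> X. dominates F z y}) \<union> {z}"

text \<open>
  The tentative direction computed at the point \<open>x\<close> in iteration \<open>k\<close> is \<open>vD k x\<close>.  The
  quantities of the refinement step depend only on \<open>k\<close>, \<open>x\<close> and \<open>vD k x\<close>, and not on the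
  current front, so they are functions: \<open>refinement_direction\<close> (\<open>d\<^sub>c\<close>), \<open>refinement_step\<close>
  (\<open>\<alpha>\<^sub>c\<close>) and \<open>refinement_point\<close> (\<open>z\<^sub>c\<close>).
\<close>

definition accept_direction ::
    "(real^'n \<Rightarrow> real^'m) \<Rightarrow> fd_params \<Rightarrow> real^'n \<Rightarrow> real^'n \<Rightarrow> bool" where
  "accept_direction F P x d \<longleftrightarrow>
     max_slope F x d \<le> - fd_Gamma1 P * (norm (steepest_direction F UNIV x))\<^sup>2 \<and>
     norm d \<le> fd_Gamma2 P * norm (steepest_direction F UNIV x)"

definition refinement_direction ::
    "(real^'n \<Rightarrow> real^'m) \<Rightarrow> fd_params \<Rightarrow> (nat \<Rightarrow> real^'n \<Rightarrow> real^'n) \<Rightarrow> nat \<Rightarrow> real^'n \<Rightarrow> real^'n"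
  where
  "refinement_direction F P vD k x =
     (if theta F UNIV x < - fd_sigma P k \<and> accept_direction F P x (vD k x)
      then vD k x else steepest_direction F UNIV x)"

definition armijo_step ::
    "(real^'n \<Rightarrow> real^'m) \<Rightarrow> fd_params \<Rightarrow> real^'n \<Rightarrow> real^'n \<Rightarrow> real" where
  "armijo_step F P x d =
     (GREATEST a. \<exists>h. a = fd_alpha0 P * fd_delta P ^ h \<and>
        F (x + a *\<^sub>R d) \<le> F x + (fd_gamma P * a * max_slope F x d) *\<^sub>R 1)"

definition refinement_step ::
    "(real^'n \<Rightarrow> real^'m) \<Rightarrow> fd_params \<Rightarrow> (nat \<Rightarrow> real^'n \<Rightarrow> real^'n) \<Rightarrow> nat \<Rightarrow> real^'n \<Rightarrow> real"
  where
  "refinement_step F P vD k x =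
     (if theta F UNIV x < - fd_sigma P k
      then armijo_step F P x (refinement_direction F P vD k x) else 0)"

definition refinement_point ::
    "(real^'n \<Rightarrow> real^'m) \<Rightarrow> fd_params \<Rightarrow> (nat \<Rightarrow> real^'n \<Rightarrow> real^'n) \<Rightarrow> nat \<Rightarrow> real^'n \<Rightarrow> real^'n"
  where
  "refinement_point F P vD k x =
     x + refinement_step F P vD k x *\<^sub>R refinement_direction F P vD k x"

definition exploration_step ::
    "(real^'n \<Rightarrow> real^'m) \<Rightarrow> fd_params \<Rightarrow> (real^'n) set \<Rightarrow> real^'n \<Rightarrow> real^'n \<Rightarrow> real" where
  "exploration_step F P X z d =
     (GREATEST a. \<exists>h. a = fd_alpha0 P * fd_delta P ^ h \<and>
        (\<forall>y\<in>X. \<exists>j. F (z + a *\<^sub>R d) $ j < F y $ j))"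

text \<open>
  \<open>explore F P z Is X E X'\<close>: running through the index sets in the list \<open>Is\<close>, the exploration
  from \<open>z\<close> turns the front \<open>X\<close> into \<open>X'\<close> and generates the points in \<open>E\<close>.
\<close>

inductive explore ::
    "(real^'n \<Rightarrow> real^'m) \<Rightarrow> fd_params \<Rightarrow> real^'n \<Rightarrow> 'm set list \<Rightarrow>
     (real^'n) set \<Rightarrow> (real^'n) set \<Rightarrow> (real^'n) set \<Rightarrow> bool"
  for F P z where
  explore_Nil: "explore F P z [] X {} X"
| explore_skip: "\<lbrakk>\<not> (theta F I z < 0 \<and> z \<in> X); explore F P z Is X E X'\<rbrakk>
    \<Longrightarrow> explore F P z (I # Is) X E X'"
| explore_step: "\<lbrakk>theta F I z < 0; z \<in> X; d = steepest_direction F I z;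
     w = z + exploration_step F P X z d *\<^sub>R d; explore F P z Is (update_front F w X) E X'\<rbrakk>
    \<Longrightarrow> explore F P z (I # Is) X (insert w E) X'"

text \<open>
  \<open>process_point F P vD k x X E X'\<close>: processing \<open>x\<close> in iteration \<open>k\<close> with current front \<open>X\<close>
  results in the front \<open>X'\<close>; \<open>E\<close> collects the exploration points.  The index sets are visited in
  an arbitrary order.
\<close>

definition process_point ::
    "(real^'n \<Rightarrow> real^'m) \<Rightarrow> fd_params \<Rightarrow> (nat \<Rightarrow> real^'n \<Rightarrow> real^'n) \<Rightarrow> nat \<Rightarrow> real^'n \<Rightarrow>
     (real^'n) set \<Rightarrow> (real^'n) set \<Rightarrow> (real^'n) set \<Rightarrow> bool" where
  "process_point F P vD k x X E X' \<longleftrightarrow>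
     (theta F UNIV x < - fd_sigma P k \<longrightarrow> common_descent_direction F x (vD k x)) \<and>
     (\<exists>Is. distinct Is \<and> set Is = {I. I \<noteq> {} \<and> I \<noteq> UNIV} \<and>
        explore F P (refinement_point F P vD k x) Is
          (update_front F (refinement_point F P vD k x) X) E X')"

text \<open>
  \<open>process_points F P vD k xs X L X'\<close>: working through the list \<open>xs\<close> in iteration \<open>k\<close>, starting
  with the front \<open>X\<close>, results in the front \<open>X'\<close>.  The log \<open>L\<close> is defined exactly on the points
  that were actually processed, i.e. still belonged to the front at their turn, and maps each of
  them to the set of exploration points generated from it.
\<close>

inductive process_points ::
    "(real^'n \<Rightarrow> real^'m) \<Rightarrow> fd_params \<Rightarrow> (nat \<Rightarrow> real^'n \<Rightarrow> real^'n) \<Rightarrow> nat \<Rightarrow> (real^'n) list \<Rightarrow>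
     (real^'n) set \<Rightarrow> (real^'n \<Rightarrow> (real^'n) set option) \<Rightarrow> (real^'n) set \<Rightarrow> bool"
  for F P vD k where
  process_Nil: "process_points F P vD k [] X Map.empty X"
| process_skip: "\<lbrakk>x \<notin> X; process_points F P vD k xs X L X'\<rbrakk>
    \<Longrightarrow> process_points F P vD k (x # xs) X L X'"
| process_step: "\<lbrakk>x \<in> X; process_point F P vD k x X E Y; process_points F P vD k xs Y L X'\<rbrakk>
    \<Longrightarrow> process_points F P vD k (x # xs) X (L(x \<mapsto> E)) X'"

definition front_descent_run ::
    "(real^'n \<Rightarrow> real^'m) \<Rightarrow> fd_params \<Rightarrow> (nat \<Rightarrow> real^'n \<Rightarrow> real^'n) \<Rightarrow> (nat \<Rightarrow> (real^'n) set) \<Rightarrow>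
     (nat \<Rightarrow> real^'n \<Rightarrow> (real^'n) set option) \<Rightarrow> bool" where
  "front_descent_run F P vD X L \<longleftrightarrow>
     valid_params P \<and> finite (X 0) \<and> X 0 \<noteq> {} \<and> mutually_nondominated F (X 0) \<and>
     (\<forall>k. \<exists>xs. distinct xs \<and> set xs = X k \<and>
        process_points F P vD k xs (X k) (L k) (X (Suc k)))"

definition linked_sequence ::
    "(real^'n \<Rightarrow> real^'m) \<Rightarrow> fd_params \<Rightarrow> (nat \<Rightarrow> real^'n \<Rightarrow> real^'n) \<Rightarrow> (nat \<Rightarrow> (real^'n) set) \<Rightarrow>
     (nat \<Rightarrow> real^'n \<Rightarrow> (real^'n) set option) \<Rightarrow> (nat \<Rightarrow> real^'n) \<Rightarrow> bool" where
  "linked_sequence F P vD X L x \<longleftrightarrow>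
     (\<forall>k. x k \<in> X k \<and>
        (\<exists>E. L k (x k) = Some E \<and>
           (x (Suc k) = refinement_point F P vD k (x k) \<or> x (Suc k) \<in> E)))"

definition refining_linked_sequence ::
    "(real^'n \<Rightarrow> real^'m) \<Rightarrow> fd_params \<Rightarrow> (nat \<Rightarrow> real^'n \<Rightarrow> real^'n) \<Rightarrow> (nat \<Rightarrow> (real^'n) set) \<Rightarrow>
     (nat \<Rightarrow> real^'n \<Rightarrow> (real^'n) set option) \<Rightarrow> (nat \<Rightarrow> real^'n) \<Rightarrow> bool" where
  "refining_linked_sequence F P vD X L x \<longleftrightarrow>
     linked_sequence F P vD X L x \<and>
     (\<exists>K. \<forall>k\<ge>K. x (Suc k) = refinement_point F P vD k (x k))"

end

theory Submission
  imports Defs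
begin

text \<open>
  Near \<open>xbar\<close> the Newton model \<open>q d = max\<^sub>h (\<nabla>f\<^sub>h(x) \<bullet> d + d \<bullet> \<nabla>\<^sup>2f\<^sub>h(x) d / 2)\<close> is strongly convex
  with modulus \<open>a = \<omega> min\<^sub>h \<lambda>\<^sub>m\<^sub>i\<^sub>n\<close> and curvature at most \<open>b = max\<^sub>h \<lambda>\<^sub>m\<^sub>a\<^sub>x / \<omega>\<close>.  Testing the
  minimality of its minimizer \<open>s\<close> against suitable points, instead of using multipliers, yields
  everything that is needed.  With \<open>D\<close> the largest slope and \<open>v\<close> the steepest descent direction,
  \<open>a \<parallel>s\<parallel> \<le> \<parallel>v\<parallel>\<close> and \<open>D s \<le> - \<parallel>v\<parallel>\<^sup>2 / (2 b)\<close> make \<open>s\<close> acceptable, and \<open>2 q s \<le> D s\<close> together with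
  \<open>q s \<le> - a \<parallel>s\<parallel>\<^sup>2 / 2\<close> and Taylor's formula gives the unit Armijo step.  Stationarity of \<open>s\<close> bounds
  the steepest descent direction at \<open>x + s\<close> by \<open>c \<parallel>s\<parallel>\<close>, where \<open>c\<close> is the variation of the Hessians
  on the segment, so the next Newton step has length at most \<open>(c / a) \<parallel>s\<parallel>\<close>.  Hence the steps at
  least halve, the iterates stay near \<open>xbar\<close> and converge to a critical point, which is locally
  Pareto optimal by convexity, and the behaviour of \<open>c\<close> gives the rates.
\<close>

section \<open>Extreme eigenvalues of symmetric matrices\<close>

lemma norm_matrix_vector_mult_le:
  fixes A :: "real^'n^'m"
  shows "norm (A *v v) \<le> norm A * norm v"
proof -
  have "norm (A *v v) \<le> L2_set (\<lambda>i. norm (A $ i) * norm v) UNIV"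
    unfolding norm_vec_def[of "A *v v"]
    by (rule L2_set_mono) (simp_all add: matrix_vector_mul_component Cauchy_Schwarz_ineq2)
  also have "\<dots> = norm A * norm v"
    by (simp add: norm_vec_def[of A] L2_set_left_distrib)
  finally show ?thesis .
qed

lemma quadratic_form_diff_le:
  fixes A B :: "real^'n^'n"
  shows "\<bar>d \<bullet> (A *v d) - d \<bullet> (B *v d)\<bar> \<le> norm (A - B) * (norm d)\<^sup>2"
proof -
  have "\<bar>d \<bullet> (A *v d) - d \<bullet> (B *v d)\<bar> = \<bar>d \<bullet> ((A - B) *v d)\<bar>"
    by (simp add: matrix_vector_mult_diff_rdistrib inner_diff_right)
  also have "\<dots> \<le> norm d * (norm (A - B) * norm d)"
    by (rule order_trans[OF Cauchy_Schwarz_ineq2])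
      (intro mult_left_mono norm_matrix_vector_mult_le norm_ge_zero)
  finally show ?thesis by (simp add: power2_eq_square mult_ac)
qed

lemma mat_vector_mult:
  fixes v :: "real^'n"
  shows "mat c *v v = c *\<^sub>R v"
proof -
  have "(\<Sum>j\<in>UNIV. (if i = j then c else 0) * v $ j) = (\<Sum>j\<in>UNIV. if i = j then c * v $ j else 0)" for i
    by (intro sum.cong) auto
  then show ?thesis by (simp add: vec_eq_iff matrix_vector_mult_def mat_def)
qed

lemma uminus_matrix_vector_mult:
  fixes A :: "real^'n^'m"
  shows "(- A) *v v = - (A *v v)"
  by (simp add: vec_eq_iff matrix_vector_mult_def sum_negf)

lemma symmetric_matrix_inner:
  fixes A :: "real^'n^'n"
  assumes "transpose A = A"
  shows "u \<bullet> (A *v w) = w \<bullet> (A *v u)"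
  by (metis assms dot_lmul_matrix inner_commute transpose_matrix_vector)

text \<open>Eigenvectors for distinct eigenvalues are orthogonal, so one per eigenvalue gives an
  independent, hence finite, set. Finiteness makes the \<open>Min\<close> and \<open>Max\<close>
  over eigenvalues meaningful.\<close>

lemma finite_eigenvalues:
  fixes A :: "real^'n^'n"
  assumes sym: "transpose A = A"
  shows "finite (eigenvalues A)"
proof -
  have "\<forall>c\<in>eigenvalues A. \<exists>v. v \<noteq> 0 \<and> A *v v = c *\<^sub>R v"
    by (auto simp: eigenvalues_def)
  then obtain e where e: "\<And>c. c \<in> eigenvalues A \<Longrightarrow> e c \<noteq> 0 \<and> A *v e c = c *\<^sub>R e c"
    by metis
  have orth: "e c \<bullet> e d = 0" if "c \<in> eigenvalues A" "d \<in> eigenvalues A" "c \<noteq> d" for c d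
  proof -
    have "d * (e c \<bullet> e d) = c * (e c \<bullet> e d)"
      using symmetric_matrix_inner[OF sym, of "e c" "e d"] e that by (simp add: inner_commute)
    then show ?thesis using that by simp
  qed
  have "inj_on e (eigenvalues A)"
    by (rule inj_onI) (metis e orth inner_eq_zero_iff)
  moreover have "independent (e ` eigenvalues A)"
  proof (rule pairwise_orthogonal_independent)
    show "pairwise orthogonal (e ` eigenvalues A)"
      by (auto simp: pairwise_def orthogonal_def intro!: orth)
    show "0 \<notin> e ` eigenvalues A" using e by auto
  qed
  ultimately show ?thesis
    using finite_imageD independent_imp_finite by blast
qed

text \<open>A zero of a nonnegative form is a minimum. Moving from \<open>u\<close> against
  \<open>A *v u\<close> lowers the form to first order, so it would become negative unless
  \<open>A *v u = 0\<close>.\<close>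

lemma psd_form_zero:
  fixes A :: "real^'n^'n"
  assumes sym: "transpose A = A" and psd: "\<And>v. 0 \<le> v \<bullet> (A *v v)" and zero: "u \<bullet> (A *v u) = 0"
  shows "A *v u = 0"
proof -
  let ?w = "A *v u"
  let ?c = "?w \<bullet> (A *v ?w)"
  have *: "0 \<le> - 2 * t * (?w \<bullet> ?w) + t\<^sup>2 * ?c" for t
  proof -
    have "(u - t *\<^sub>R ?w) \<bullet> (A *v (u - t *\<^sub>R ?w)) = - 2 * t * (?w \<bullet> ?w) + t\<^sup>2 * ?c"
      using zero symmetric_matrix_inner[OF sym, of u ?w]
      by (simp add: matrix_vector_mult_diff_distrib matrix_vector_mult_scaleR inner_diff_left
          inner_diff_right power2_eq_square algebra_simps)
    with psd[of "u - t *\<^sub>R ?w"] show ?thesis by simp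
  qed
  have c0: "?c \<ge> 0" by (rule psd)
  \<comment> \<open>The optimal step would divide by \<open>?c\<close>; the added 1 covers
    \<open>?c = 0\<close>.\<close>
  define t where "t = (?w \<bullet> ?w) / (?c + 1)"
  have "t \<ge> 0" and tc: "t * (?c + 1) = ?w \<bullet> ?w" using c0 by (auto simp: t_def)
  have "0 \<le> t * (- 2 * (t * (?c + 1)) + t * ?c)"
    using *[of t] unfolding tc by (simp add: power2_eq_square algebra_simps)
  then have "0 \<le> - (t\<^sup>2 * (?c + 2))" by (simp add: power2_eq_square algebra_simps)
  moreover have "t\<^sup>2 * (?c + 2) \<ge> t\<^sup>2 * 2" using c0 by (intro mult_left_mono) auto
  ultimately have "t\<^sup>2 \<le> 0" by linarith
  then have "t = 0" by simp
  then show ?thesis using tc by simp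
qed

text \<open>The minimum \<open>c\<close> of the form on the unit sphere exists by compactness and
  gives the bound for all vectors by scaling. A minimizer is a zero of the nonnegative form of
  \<open>A - mat c\<close>, hence an eigenvector.\<close>

lemma lambda_min_symmetric:
  fixes A :: "real^'n^'n"
  assumes sym: "transpose A = A"
  shows "lambda_min A \<in> eigenvalues A" and "lambda_min A * (norm v)\<^sup>2 \<le> v \<bullet> (A *v v)"
proof -
  have "continuous_on (sphere 0 1) (\<lambda>v. v \<bullet> (A *v v))"
    by (intro continuous_intros)
  moreover have "sphere (0::real^'n) 1 \<noteq> {}" by (simp add: sphere_eq_empty)
  ultimately obtain u where u: "norm u = 1"
    and min: "\<And>v. norm v = 1 \<Longrightarrow> u \<bullet> (A *v u) \<le> v \<bullet> (A *v v)"
    using continuous_attains_inf[of "sphere 0 1" "\<lambda>v. v \<bullet> (A *v v)"] by (auto simp: dist_norm)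
  define c where "c = u \<bullet> (A *v u)"
  have ray: "c * (norm v)\<^sup>2 \<le> v \<bullet> (A *v v)" for v
  proof (cases "v = 0")
    case False
    then have "c \<le> (v /\<^sub>R norm v) \<bullet> (A *v (v /\<^sub>R norm v))"
      unfolding c_def by (intro min) simp
    also have "\<dots> = (v \<bullet> (A *v v)) / (norm v)\<^sup>2"
      by (simp add: matrix_vector_mult_scaleR power2_eq_square divide_simps)
    finally show ?thesis using False by (simp add: field_simps)
  qed simp
  let ?B = "A - mat c"
  have B: "?B *v v = A *v v - c *\<^sub>R v" for v
    by (simp add: matrix_vector_mult_diff_rdistrib mat_vector_mult)
  have "?B *v u = 0"
  proof (rule psd_form_zero)
    show "transpose ?B = ?B" using sym by (auto simp: transpose_def mat_def vec_eq_iff)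
    show "0 \<le> v \<bullet> (?B *v v)" for v
      using ray[of v] by (simp add: B inner_diff_right power2_norm_eq_inner)
    show "u \<bullet> (?B *v u) = 0"
      using u unfolding B by (simp add: inner_diff_right c_def norm_eq_1)
  qed
  then have c_in: "c \<in> eigenvalues A" using u by (auto simp: B eigenvalues_def intro!: exI[of _ u])
  have "c \<le> d" if d: "d \<in> eigenvalues A" for d
  proof -
    obtain v where v: "v \<noteq> 0" "A *v v = d *\<^sub>R v" using d by (auto simp: eigenvalues_def)
    then have "c * (norm v)\<^sup>2 \<le> d * (norm v)\<^sup>2" using ray[of v] by (simp add: power2_norm_eq_inner)
    then show ?thesis using v by simp
  qed
  then have "lambda_min A = c"
    unfolding lambda_min_def using c_in finite_eigenvalues[OF sym] by (intro Min_eqI) auto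
  then show "lambda_min A \<in> eigenvalues A" "lambda_min A * (norm v)\<^sup>2 \<le> v \<bullet> (A *v v)"
    using c_in ray by auto
qed

lemma lambda_max_eq_lambda_min_uminus:
  fixes A :: "real^'n^'n"
  assumes sym: "transpose A = A"
  shows "lambda_max A = - lambda_min (- A)"
proof -
  have sym': "transpose (- A) = - A" using sym by (simp add: transpose_def vec_eq_iff)
  have *: "c \<in> eigenvalues (- A) \<longleftrightarrow> - c \<in> eigenvalues A" for c
  proof -
    have "- (A *v v) = c *\<^sub>R v \<longleftrightarrow> A *v v = - (c *\<^sub>R v)" for v
      by (rule minus_equation_iff[THEN trans]) (rule eq_commute)
    then show ?thesis by (simp add: eigenvalues_def uminus_matrix_vector_mult)
  qed
  have "- lambda_min (- A) \<in> eigenvalues A"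
    using lambda_min_symmetric(1)[OF sym'] * by simp
  moreover have "c \<le> - lambda_min (- A)" if "c \<in> eigenvalues A" for c
    using Min_le[OF finite_eigenvalues[OF sym'], of "- c"] that by (simp add: * lambda_min_def)
  ultimately show ?thesis
    unfolding lambda_max_def using finite_eigenvalues[OF sym] by (intro Max_eqI) auto
qed

lemma lambda_max_symmetric:
  fixes A :: "real^'n^'n"
  assumes sym: "transpose A = A"
  shows "v \<bullet> (A *v v) \<le> lambda_max A * (norm v)\<^sup>2"
proof -
  have "transpose (- A) = - A" using sym by (simp add: transpose_def vec_eq_iff)
  from lambda_min_symmetric(2)[OF this, of v] show ?thesis
    by (simp add: lambda_max_eq_lambda_min_uminus[OF sym] uminus_matrix_vector_mult)
qed

lemma le_lambda_min:
  fixes A :: "real^'n^'n"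
  assumes sym: "transpose A = A" and "\<And>v. c * (norm v)\<^sup>2 \<le> v \<bullet> (A *v v)"
  shows "c \<le> lambda_min A"
proof -
  obtain v where v: "v \<noteq> 0" "A *v v = lambda_min A *\<^sub>R v"
    using lambda_min_symmetric(1)[OF sym] by (auto simp: eigenvalues_def)
  then have "c * (norm v)\<^sup>2 \<le> lambda_min A * (norm v)\<^sup>2"
    using assms(2)[of v] by (simp add: power2_norm_eq_inner)
  then show ?thesis using v by simp
qed

lemma lambda_min_pos:
  fixes A :: "real^'n^'n"
  assumes sym: "transpose A = A" and "positive_definite A"
  shows "0 < lambda_min A"
proof -
  obtain v where v: "v \<noteq> 0" "A *v v = lambda_min A *\<^sub>R v"
    using lambda_min_symmetric(1)[OF sym] by (auto simp: eigenvalues_def)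
  then have "0 < lambda_min A * (norm v)\<^sup>2"
    using assms(2) by (auto simp: positive_definite_def power2_norm_eq_inner)
  then show ?thesis by (simp add: zero_less_mult_iff)
qed

lemma lambda_min_le_lambda_max:
  fixes A :: "real^'n^'n"
  assumes sym: "transpose A = A"
  shows "lambda_min A \<le> lambda_max A"
  unfolding lambda_max_def
  using lambda_min_symmetric(1)[OF sym] finite_eigenvalues[OF sym] by simp

section \<open>Second-order calculus\<close>

text \<open>\<open>gradient\<close> is a definite description: the adjoint of the derivative,
  applied to 1, supplies existence, and uniqueness of derivatives does the rest.\<close>

lemma gradient_has_derivative:
  assumes "f differentiable (at x)"
  shows "(f has_derivative (\<lambda>h. gradient f x \<bullet> h)) (at x)"
proof -
  obtain f' where f': "(f has_derivative f') (at x)" using assms by (auto simp: differentiable_def)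
  then have "linear f'" by (rule has_derivative_linear)
  then have "f' = (\<lambda>h. h \<bullet> adjoint f' 1)" using adjoint_works[of f' _ 1] by (auto simp: fun_eq_iff)
  then have D: "GDERIV f x :> adjoint f' 1" using f' by (simp add: gderiv_def)
  moreover have "g = adjoint f' 1" if "GDERIV f x :> g" for g
  proof -
    have "(\<lambda>h. h \<bullet> g) = (\<lambda>h. h \<bullet> adjoint f' 1)"
      using that D unfolding gderiv_def by (rule has_derivative_unique)
    then show ?thesis by (metis vector_eq_ldot)
  qed
  ultimately have "GDERIV f x :> gradient f x" unfolding gradient_def by (rule theI)
  then show ?thesis by (simp add: gderiv_def inner_commute)
qed

context
  fixes f :: "real^'n \<Rightarrow> real"
  assumes C2: "twice_continuously_differentiable f"
begin

lemma has_derivative_gradient_C2: "(f has_derivative (\<lambda>h. gradient f x \<bullet> h)) (at x)"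
  using C2 gradient_has_derivative by (auto simp: twice_continuously_differentiable_def)

lemma has_derivative_hessian_C2: "(gradient f has_derivative (\<lambda>h. hessian f x *v h)) (at x)"
  using C2 jacobian_works by (auto simp: twice_continuously_differentiable_def hessian_def)

lemma continuous_hessian_C2:
  assumes "e > 0"
  shows "\<exists>d>0. \<forall>y. dist y x < d \<longrightarrow> norm (hessian f y - hessian f x) < e"
  using C2 assms unfolding twice_continuously_differentiable_def continuous_on_iff dist_norm
  by (metis UNIV_I)

lemma DERIV_along_line:
  "((\<lambda>t. f (y + t *\<^sub>R u)) has_real_derivative gradient f (y + t *\<^sub>R u) \<bullet> u) (at t)"
proof -
  have "((\<lambda>t. y + t *\<^sub>R u) has_derivative (\<lambda>h. h *\<^sub>R u)) (at t)"
    by (auto intro!: derivative_eq_intros)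
  from has_derivative_compose[OF this has_derivative_gradient_C2]
  show ?thesis
    unfolding has_field_derivative_def by (rule has_derivative_eq_rhs) (simp add: fun_eq_iff)
qed

lemma DERIV_gradient_along_line:
  "((\<lambda>t. gradient f (y + t *\<^sub>R u) \<bullet> w) has_real_derivative w \<bullet> (hessian f (y + t *\<^sub>R u) *v u)) (at t)"
proof -
  have "((\<lambda>t. y + t *\<^sub>R u) has_derivative (\<lambda>h. h *\<^sub>R u)) (at t)"
    by (auto intro!: derivative_eq_intros)
  from has_derivative_inner_left[OF has_derivative_compose[OF this has_derivative_hessian_C2], of w]
  show ?thesis
    unfolding has_field_derivative_def
    by (rule has_derivative_eq_rhs) (simp add: fun_eq_iff matrix_vector_mult_scaleR inner_commute)
qed

text \<open>The mean value theorem is applied twice: along \<open>u\<close> to the difference of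
  \<open>f\<close> on two parallel lines, then along \<open>w\<close> to the slope in direction
  \<open>u\<close>.\<close>

lemma second_difference:
  assumes "t > 0"
  shows "\<exists>\<tau> \<sigma>. 0 < \<tau> \<and> \<tau> < t \<and> 0 < \<sigma> \<and> \<sigma> < t \<and>
    f (x + t *\<^sub>R u + t *\<^sub>R w) - f (x + t *\<^sub>R u) - f (x + t *\<^sub>R w) + f x
      = t\<^sup>2 * (u \<bullet> (hessian f (x + \<tau> *\<^sub>R u + \<sigma> *\<^sub>R w) *v w))"
proof -
  let ?\<phi> = "\<lambda>\<tau>. f ((x + t *\<^sub>R w) + \<tau> *\<^sub>R u) - f (x + \<tau> *\<^sub>R u)"
  have "\<exists>\<tau>. 0 < \<tau> \<and> \<tau> < t \<and> ?\<phi> t - ?\<phi> 0 =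
    (t - 0) * (gradient f ((x + t *\<^sub>R w) + \<tau> *\<^sub>R u) \<bullet> u - gradient f (x + \<tau> *\<^sub>R u) \<bullet> u)"
    by (rule MVT2) (auto intro!: DERIV_diff DERIV_along_line assms)
  then obtain \<tau> where \<tau>: "0 < \<tau>" "\<tau> < t" "?\<phi> t - ?\<phi> 0 =
    t * (gradient f ((x + t *\<^sub>R w) + \<tau> *\<^sub>R u) \<bullet> u - gradient f (x + \<tau> *\<^sub>R u) \<bullet> u)" by auto
  let ?\<psi> = "\<lambda>\<sigma>. gradient f ((x + \<tau> *\<^sub>R u) + \<sigma> *\<^sub>R w) \<bullet> u"
  have "\<exists>\<sigma>. 0 < \<sigma> \<and> \<sigma> < t \<and>
    ?\<psi> t - ?\<psi> 0 = (t - 0) * (u \<bullet> (hessian f ((x + \<tau> *\<^sub>R u) + \<sigma> *\<^sub>R w) *v w))"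
    by (rule MVT2) (auto intro!: DERIV_gradient_along_line assms)
  then obtain \<sigma> where "0 < \<sigma>" "\<sigma> < t"
    "?\<psi> t - ?\<psi> 0 = t * (u \<bullet> (hessian f (x + \<tau> *\<^sub>R u + \<sigma> *\<^sub>R w) *v w))" by auto
  with \<tau> show ?thesis
    by (intro exI[of _ \<tau>] exI[of _ \<sigma>]) (simp add: add_ac power2_eq_square)
qed

text \<open>The second difference is symmetric in \<open>u\<close> and \<open>w\<close>, so its two
  mean value forms agree at points near \<open>x\<close>. Continuity of the Hessian keeps each
  within half of the supposed gap.\<close>

lemma hessian_symmetric: "transpose (hessian f x) = hessian f x"
proof -
  have "u \<bullet> (hessian f x *v w) = w \<bullet> (hessian f x *v u)" for u w
  proof (rule ccontr)
    assume neq: "u \<bullet> (hessian f x *v w) \<noteq> w \<bullet> (hessian f x *v u)"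
    define \<delta> where "\<delta> = \<bar>u \<bullet> (hessian f x *v w) - w \<bullet> (hessian f x *v u)\<bar>"
    define e where "e = \<delta> / (2 * (norm u * norm w + 1))"
    have pos: "norm u * norm w + 1 > 0"
      by (simp add: add_nonneg_pos)
    have "\<delta> > 0" "e > 0" using neq pos by (auto simp: \<delta>_def e_def)
    then obtain d where d: "d > 0" "\<And>y. dist y x < d \<Longrightarrow> norm (hessian f y - hessian f x) < e"
      using continuous_hessian_C2 by metis
    \<comment> \<open>Keeps all intermediate points within \<open>d / 2\<close> of
      \<open>x\<close>.\<close>
    define t where "t = d / (2 * (norm u + norm w + 1))"
    have npos: "norm u + norm w + 1 > 0" by (simp add: add_nonneg_pos)
    then have "t > 0" using d by (simp add: t_def)
    have near: "dist (x + a *\<^sub>R p + b *\<^sub>R q) x < d"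
      if "0 < a" "a < t" "0 < b" "b < t" "norm p + norm q = norm u + norm w" for a b p q
    proof -
      have "dist (x + a *\<^sub>R p + b *\<^sub>R q) x \<le> a * norm p + b * norm q"
        using that norm_triangle_ineq[of "a *\<^sub>R p" "b *\<^sub>R q"] by (simp add: dist_norm add.assoc)
      also have "\<dots> \<le> t * norm p + t * norm q"
        using that by (intro add_mono mult_right_mono) auto
      also have "\<dots> = t * (norm u + norm w)" using that(5) by (metis distrib_left)
      also have "\<dots> \<le> t * (norm u + norm w + 1)" using \<open>t > 0\<close> by simp
      also have "\<dots> = d / 2" using npos unfolding t_def by (simp add: divide_simps)
      finally show ?thesis using d by simp
    qed
    have err: "\<bar>p \<bullet> (hessian f y *v q) - p \<bullet> (hessian f x *v q)\<bar> < \<delta> / 2"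
      if "dist y x < d" "norm p * norm q = norm u * norm w" for y p q
    proof -
      have "\<bar>p \<bullet> (hessian f y *v q) - p \<bullet> (hessian f x *v q)\<bar>
          = \<bar>p \<bullet> ((hessian f y - hessian f x) *v q)\<bar>"
        by (simp add: matrix_vector_mult_diff_rdistrib inner_diff_right)
      also have "\<dots> \<le> norm p * (norm (hessian f y - hessian f x) * norm q)"
        by (rule order_trans[OF Cauchy_Schwarz_ineq2])
          (intro mult_left_mono norm_matrix_vector_mult_le norm_ge_zero)
      also have "\<dots> = norm (hessian f y - hessian f x) * (norm u * norm w)"
        by (simp flip: that(2))
      also have "\<dots> \<le> e * (norm u * norm w)"
        using d(2)[OF that(1)] by (intro mult_right_mono) auto
      also have "\<dots> < e * (norm u * norm w + 1)" using \<open>e > 0\<close> by simp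
      also have "\<dots> = \<delta> / 2" using pos unfolding e_def by (simp add: divide_simps)
      finally show ?thesis .
    qed
    obtain a b where 1: "0 < a" "a < t" "0 < b" "b < t"
      "f (x + t *\<^sub>R u + t *\<^sub>R w) - f (x + t *\<^sub>R u) - f (x + t *\<^sub>R w) + f x
        = t\<^sup>2 * (u \<bullet> (hessian f (x + a *\<^sub>R u + b *\<^sub>R w) *v w))"
      using second_difference[OF \<open>t > 0\<close>] by metis
    obtain a' b' where 2: "0 < a'" "a' < t" "0 < b'" "b' < t"
      "f (x + t *\<^sub>R w + t *\<^sub>R u) - f (x + t *\<^sub>R w) - f (x + t *\<^sub>R u) + f x
        = t\<^sup>2 * (w \<bullet> (hessian f (x + a' *\<^sub>R w + b' *\<^sub>R u) *v u))"
      using second_difference[OF \<open>t > 0\<close>] by metis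
    have "t\<^sup>2 * (u \<bullet> (hessian f (x + a *\<^sub>R u + b *\<^sub>R w) *v w))
        = t\<^sup>2 * (w \<bullet> (hessian f (x + a' *\<^sub>R w + b' *\<^sub>R u) *v u))"
      using 1(5) 2(5) by (simp add: algebra_simps)
    then have "u \<bullet> (hessian f (x + a *\<^sub>R u + b *\<^sub>R w) *v w)
        = w \<bullet> (hessian f (x + a' *\<^sub>R w + b' *\<^sub>R u) *v u)"
      using \<open>t > 0\<close> by simp
    moreover have "\<bar>u \<bullet> (hessian f (x + a *\<^sub>R u + b *\<^sub>R w) *v w) - u \<bullet> (hessian f x *v w)\<bar> < \<delta> / 2"
      using 1 by (intro err near) auto
    moreover have "\<bar>w \<bullet> (hessian f (x + a' *\<^sub>R w + b' *\<^sub>R u) *v u) - w \<bullet> (hessian f x *v u)\<bar> < \<delta> / 2"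
      using 2 by (intro err near) auto
    ultimately show False unfolding \<delta>_def by (auto simp: abs_if split: if_splits)
  qed
  then have "hessian f x $ i $ j = hessian f x $ j $ i" for i j
    by (metis inner_axis matrix_vector_mul_component inner_axis' inner_real_def mult.left_neutral
        mult.right_neutral)
  then show ?thesis by (simp add: transpose_def vec_eq_iff)
qed

lemma taylor_second_order:
  "\<exists>t. 0 < t \<and> t < 1 \<and>
    f (x + s) = f x + gradient f x \<bullet> s + (1/2) * (s \<bullet> (hessian f (x + t *\<^sub>R s) *v s))"
proof -
  let ?D = "\<lambda>(m::nat) t. if m = 0 then f (x + t *\<^sub>R s) else if m = 1 then gradient f (x + t *\<^sub>R s) \<bullet> s
     else s \<bullet> (hessian f (x + t *\<^sub>R s) *v s)"
  have "\<exists>t::real. 0 < t \<and> t < 1 \<and>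
      f (x + 1 *\<^sub>R s) = sum (\<lambda>m. (?D m 0 / fact m) * 1 ^ m) {..<2} + (?D 2 t / fact 2) * 1 ^ 2"
  proof (rule Maclaurin)
    show "\<forall>m t. m < 2 \<and> 0 \<le> t \<and> t \<le> 1 \<longrightarrow> DERIV (?D m) t :> ?D (Suc m) t"
      using DERIV_along_line DERIV_gradient_along_line by (auto simp: less_2_cases_iff)
  qed auto
  then show ?thesis by (auto simp: numeral_2_eq_2)
qed

text \<open>The mean value inequality is applied on the segment itself, so only the variation of the
  Hessian along the step counts; this variation later determines both rates.\<close>

lemma gradient_linearization_error:
  assumes "\<And>t. 0 \<le> t \<Longrightarrow> t \<le> 1 \<Longrightarrow> norm (hessian f (x + t *\<^sub>R s) - hessian f x) \<le> e"
  shows "norm (gradient f (x + s) - gradient f x - hessian f x *v s) \<le> e * norm s"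
proof -
  have "norm (gradient f (x + s) - gradient f x - hessian f x *v (x + s - x))
      \<le> norm (x + s - x) * e"
  proof (rule differentiable_bound_linearization[where ?x0.0 = x and f' = "\<lambda>y. (*v) (hessian f y)"
        and S = "(\<lambda>t. x + t *\<^sub>R s) ` {0..1}"])
    show "(gradient f has_derivative (*v) (hessian f y)) (at y within (\<lambda>t. x + t *\<^sub>R s) ` {0..1})" for y
      by (rule has_derivative_at_withinI[OF has_derivative_hessian_C2])
    fix y assume "y \<in> (\<lambda>t. x + t *\<^sub>R s) ` {0..1}"
    then have *: "norm (hessian f y - hessian f x) \<le> e" using assms by auto
    show "onorm ((*v) (hessian f y) - (*v) (hessian f x)) \<le> e"
    proof (rule onorm_le)
      fix i
      have "norm (((*v) (hessian f y) - (*v) (hessian f x)) i) = norm ((hessian f y - hessian f x) *v i)"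
        by (simp add: matrix_vector_mult_diff_rdistrib)
      also have "\<dots> \<le> norm (hessian f y - hessian f x) * norm i"
        by (rule norm_matrix_vector_mult_le)
      also have "\<dots> \<le> e * norm i" using * by (rule mult_right_mono) simp
      finally show "norm (((*v) (hessian f y) - (*v) (hessian f x)) i) \<le> e * norm i" .
    qed
  qed (auto intro: image_eqI[where x = 0])
  then show ?thesis by (simp add: mult.commute)
qed

end

section \<open>Maxima of strongly convex quadratics\<close>

definition max_linear :: "('m::finite \<Rightarrow> real^'n) \<Rightarrow> real^'n \<Rightarrow> real" where
  "max_linear g d = (MAX h. g h \<bullet> d)"

text \<open>Free families \<open>g\<close> and \<open>B\<close> cover two models at once: Hessians
  in \<open>B\<close> give the Newton model, identity matrices the steepest descent model.\<close>

definition max_quadratic ::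
    "('m::finite \<Rightarrow> real^'n) \<Rightarrow> ('m \<Rightarrow> real^'n^'n) \<Rightarrow> real^'n \<Rightarrow> real" where
  "max_quadratic g B d = (MAX h. g h \<bullet> d + (1/2) * (d \<bullet> (B h *v d)))"

lemma max_linear_ge: "g h \<bullet> d \<le> max_linear g d"
  unfolding max_linear_def by (rule Max_ge) auto

lemma max_linear_attained: "\<exists>h. max_linear g d = g h \<bullet> d"
proof -
  have "max_linear g d \<in> range (\<lambda>h. g h \<bullet> d)" unfolding max_linear_def by (rule Max_in) auto
  then show ?thesis by auto
qed

lemma max_quadratic_ge: "g h \<bullet> d + (1/2) * (d \<bullet> (B h *v d)) \<le> max_quadratic g B d"
  unfolding max_quadratic_def by (rule Max_ge) auto

lemma max_quadratic_attained: "\<exists>h. max_quadratic g B d = g h \<bullet> d + (1/2) * (d \<bullet> (B h *v d))"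
proof -
  have "max_quadratic g B d \<in> range (\<lambda>h. g h \<bullet> d + (1/2) * (d \<bullet> (B h *v d)))"
    unfolding max_quadratic_def by (rule Max_in) auto
  then show ?thesis by auto
qed

lemma max_quadratic_0 [simp]: "max_quadratic g B 0 = 0"
  using max_quadratic_attained[of g B 0] by auto

text \<open>Lets \<open>t\<close> tend to 0 after an inequality between model values has been
  divided by the size of a perturbation.\<close>

lemma le_from_small_perturbation:
  fixes p q r :: real
  assumes "\<And>t. 0 < t \<Longrightarrow> t < 1 \<Longrightarrow> p \<le> q + t * r"
  shows "p \<le> q"
proof (rule field_le_epsilon)
  fix e :: real assume "e > 0"
  define t where "t = min (1/2) (e / (\<bar>r\<bar> + 1))"
  have t: "0 < t" "t < 1" using \<open>e > 0\<close> by (auto simp: t_def)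
  have "t * r \<le> t * (\<bar>r\<bar> + 1)" using t by (intro mult_left_mono) auto
  also have "\<dots> \<le> e / (\<bar>r\<bar> + 1) * (\<bar>r\<bar> + 1)" by (intro mult_right_mono) (auto simp: t_def)
  also have "\<dots> = e" by simp
  finally show "p \<le> q + e" using assms[OF t] by linarith
qed

locale strongly_convex_model =
  fixes g :: "'m::finite \<Rightarrow> real^'n" and B :: "'m \<Rightarrow> real^'n^'n" and a b :: real
  assumes a_pos: "0 < a" and b_pos: "0 < b"
    and sym: "transpose (B h) = B h"
    and lower: "a * (norm d)\<^sup>2 \<le> d \<bullet> (B h *v d)"
    and upper: "d \<bullet> (B h *v d) \<le> b * (norm d)\<^sup>2"
begin

abbreviation q :: "real^'n \<Rightarrow> real" where "q \<equiv> max_quadratic g B"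

definition s :: "real^'n" where "s = the_minimizer q"

text \<open>Only the index attaining the maximum at the intermediate point matters: its quadratic
  interpolates exactly up to the term in \<open>d - c\<close>, and its values at \<open>c\<close>
  and \<open>d\<close> are at most those of \<open>q\<close>.\<close>

lemma strong_convexity:
  assumes t: "0 \<le> t" "t \<le> 1"
  shows "q ((1 - t) *\<^sub>R c + t *\<^sub>R d) \<le> (1 - t) * q c + t * q d - a / 2 * t * (1 - t) * (norm (d - c))\<^sup>2"
proof -
  let ?p = "(1 - t) *\<^sub>R c + t *\<^sub>R d"
  obtain h where h: "q ?p = g h \<bullet> ?p + (1/2) * (?p \<bullet> (B h *v ?p))"
    using max_quadratic_attained by blast
  have quad: "?p \<bullet> (B h *v ?p) = (1 - t) * (c \<bullet> (B h *v c)) + t * (d \<bullet> (B h *v d))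
      - t * (1 - t) * ((d - c) \<bullet> (B h *v (d - c)))"
    by (simp add: matrix_vector_mult_scaleR matrix_vector_mult_diff_distrib
        matrix_vector_right_distrib inner_left_distrib inner_right_distrib inner_diff_left
        inner_diff_right algebra_simps)
  have "a * (norm (d - c))\<^sup>2 * (t * (1 - t)) \<le> (d - c) \<bullet> (B h *v (d - c)) * (t * (1 - t))"
    using t by (intro mult_right_mono lower) auto
  moreover have "(1 - t) * (g h \<bullet> c + (1/2) * (c \<bullet> (B h *v c))) \<le> (1 - t) * q c"
    using t by (intro mult_left_mono max_quadratic_ge) auto
  moreover have "t * (g h \<bullet> d + (1/2) * (d \<bullet> (B h *v d))) \<le> t * q d"
    using t by (intro mult_left_mono max_quadratic_ge) auto
  ultimately show ?thesis
    unfolding h quad inner_right_distrib inner_scaleR_right ring_distribs by (simp add: field_simps)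
qed

lemma convex_on_q: "convex_on UNIV q"
proof (rule convex_onI)
  fix t and c d :: "real^'n" assume t: "0 < (t::real)" "t < 1"
  then have "0 \<le> a / 2 * t * (1 - t) * (norm (d - c))\<^sup>2" using a_pos by simp
  then show "q ((1 - t) *\<^sub>R c + t *\<^sub>R d) \<le> (1 - t) * q c + t * q d"
    using strong_convexity[of t c d] t by linarith
qed simp

text \<open>Minimality bounds the left side of \<open>strong_convexity\<close> below by
  \<open>q c\<close>; dividing by \<open>t\<close> and letting it tend to 0 leaves the full
  modulus.\<close>

lemma growth_at_minimizer:
  assumes min: "\<And>d. q c \<le> q d"
  shows "q c + a / 2 * (norm (d - c))\<^sup>2 \<le> q d"
proof (rule le_from_small_perturbation)
  fix t :: real assume t: "0 < t" "t < 1"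
  have "q c \<le> (1 - t) * q c + t * q d - a / 2 * t * (1 - t) * (norm (d - c))\<^sup>2"
    using strong_convexity[of t c d] min t by (meson less_imp_le order_trans)
  then have "t * (q c + a / 2 * (norm (d - c))\<^sup>2) \<le> t * (q d + t * (a / 2 * (norm (d - c))\<^sup>2))"
    by (simp add: field_simps)
  then show "q c + a / 2 * (norm (d - c))\<^sup>2 \<le> q d + t * (a / 2 * (norm (d - c))\<^sup>2)"
    using t by simp
qed

lemma minimizer_exists: "\<exists>c. \<forall>d. q c \<le> q d"
proof -
  fix h0 :: 'm
  \<comment> \<open>Beyond this radius the curvature of a single index outweighs its linear term, so
    \<open>q\<close> is nonnegative there and cannot undercut \<open>q 0 = 0\<close>.\<close>
  define R where "R = 2 * norm (g h0) / a"
  have "R \<ge> 0" using a_pos by (simp add: R_def)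
  have "continuous_on UNIV q" by (rule convex_on_continuous[OF open_UNIV convex_on_q])
  then have "continuous_on (cball 0 R) q" by (rule continuous_on_subset) simp
  then obtain c where c: "c \<in> cball 0 R" "\<And>d. d \<in> cball 0 R \<Longrightarrow> q c \<le> q d"
    using continuous_attains_inf[of "cball 0 R" q] \<open>R \<ge> 0\<close> by auto
  have "q c \<le> q d" if "d \<notin> cball 0 R" for d
  proof -
    have "q c \<le> 0" using c(2)[of 0] \<open>R \<ge> 0\<close> by simp
    also have "0 \<le> norm d * (a / 2 * norm d - norm (g h0))"
      using that a_pos by (intro mult_nonneg_nonneg) (auto simp: R_def field_simps)
    also have "\<dots> \<le> g h0 \<bullet> d + (1/2) * (d \<bullet> (B h0 *v d))"
      using Cauchy_Schwarz_ineq2[of "g h0" d] lower[of d h0]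
      by (simp add: power2_eq_square algebra_simps abs_le_iff)
    also have "\<dots> \<le> q d" by (rule max_quadratic_ge)
    finally show ?thesis .
  qed
  with c show ?thesis by blast
qed

lemma s_minimal: "q s \<le> q d"
proof -
  obtain c where c: "\<And>d. q c \<le> q d" using minimizer_exists by blast
  have uniq: "d = c" if "is_arg_min q (\<lambda>_. True) d" for d
  proof -
    have "q d \<le> q c" using that by (meson is_arg_min_linorder)
    then have "a / 2 * (norm (d - c))\<^sup>2 \<le> 0" using growth_at_minimizer[OF c, of d] by linarith
    then show ?thesis using a_pos by (simp add: mult_le_0_iff)
  qed
  have "is_arg_min q (\<lambda>_. True) c" using c by (simp add: is_arg_min_linorder)
  then have "is_arg_min q (\<lambda>_. True) s" unfolding s_def the_minimizer_def using uniq by (rule theI)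
  then show ?thesis by (simp add: is_arg_min_linorder)
qed

lemma growth: "q s + a / 2 * (norm (d - s))\<^sup>2 \<le> q d"
  by (rule growth_at_minimizer) (rule s_minimal)

lemma q_s_le: "q s \<le> - (a / 2 * (norm s)\<^sup>2)"
  using growth[of 0] by simp

lemma slope_s_le: "max_linear g s \<le> q s - a / 2 * (norm s)\<^sup>2"
proof -
  obtain h where "max_linear g s = g h \<bullet> s" using max_linear_attained by blast
  then show ?thesis using max_quadratic_ge[of g h s B] lower[of s h] by linarith
qed

text \<open>Comparing \<^term>\<open>s\<close> with \<open>\<tau> s\<close> for \<open>\<tau>\<close> increasing to 1 replaces the multipliers of
  the optimality system, which would give \<open>2 * q s\<close> as a convex combination of the slopes.\<close>

lemma slope_s_ge: "2 * q s \<le> max_linear g s"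
proof (rule le_from_small_perturbation)
  fix t :: real assume t: "0 < t" "t < 1"
  define \<tau> where "\<tau> = 1 - t"
  have \<tau>: "0 < \<tau>" "\<tau> < 1" using t by (auto simp: \<tau>_def)
  obtain h where h: "q (\<tau> *\<^sub>R s) = g h \<bullet> (\<tau> *\<^sub>R s) + (1/2) * ((\<tau> *\<^sub>R s) \<bullet> (B h *v (\<tau> *\<^sub>R s)))"
    using max_quadratic_attained by blast
  define l where "l = g h \<bullet> s"
  have "q s \<le> \<tau> * l + \<tau>\<^sup>2 * ((1/2) * (s \<bullet> (B h *v s)))"
    using s_minimal[of "\<tau> *\<^sub>R s"] unfolding h
    by (simp add: matrix_vector_mult_scaleR power2_eq_square l_def)
  \<comment> \<open>The index is active at \<open>\<tau> *\<^sub>R s\<close>, but its value at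
    \<open>s\<close> is still at most \<open>q s\<close>, which bounds its quadratic part by
    \<open>q s - l\<close>.\<close>
  also have "\<dots> \<le> \<tau> * l + \<tau>\<^sup>2 * (q s - l)"
    using max_quadratic_ge[of g h s B] by (intro add_left_mono mult_left_mono) (auto simp: l_def)
  finally have "(1 - \<tau>) * ((1 + \<tau>) * q s) \<le> (1 - \<tau>) * (\<tau> * l)"
    by (simp add: algebra_simps power2_eq_square)
  then have *: "(1 + \<tau>) * q s \<le> \<tau> * l" using \<tau> by simp
  also have "\<tau> * l \<le> \<tau> * max_linear g s"
    using \<tau> by (intro mult_left_mono) (auto simp: l_def max_linear_ge)
  finally show "2 * q s \<le> max_linear g s + t * (q s - max_linear g s)"
    by (simp add: \<tau>_def algebra_simps)
qed

text \<open>To first order, \<open>q\<close> grows from \<open>s\<close> along \<open>d\<close> by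
  at most the maximum of these slopes over all indices, so minimality makes that maximum
  nonnegative. The index may depend on \<open>d\<close>.\<close>

lemma stationarity: "\<exists>h. 0 \<le> (g h + B h *v s) \<bullet> d"
proof -
  let ?r = "max_linear (\<lambda>h. g h + B h *v s) d"
  have "0 \<le> ?r"
  proof (rule le_from_small_perturbation)
    fix t :: real assume t: "0 < t" "t < 1"
    obtain h where h: "q (s + t *\<^sub>R d) =
        g h \<bullet> (s + t *\<^sub>R d) + (1/2) * ((s + t *\<^sub>R d) \<bullet> (B h *v (s + t *\<^sub>R d)))"
      using max_quadratic_attained by blast
    have "q s \<le> q (s + t *\<^sub>R d)" by (rule s_minimal)
    also have "\<dots> = (g h \<bullet> s + (1/2) * (s \<bullet> (B h *v s))) + t * ((g h + B h *v s) \<bullet> d)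
        + t * (t * ((1/2) * (d \<bullet> (B h *v d))))"
      using symmetric_matrix_inner[OF sym, of s h d] unfolding h
      by (simp add: matrix_vector_mult_scaleR matrix_vector_right_distrib inner_left_distrib
          inner_right_distrib inner_commute[of d "B h *v s"] algebra_simps)
    also have "\<dots> \<le> q s + t * ?r + t * (t * (b / 2 * (norm d)\<^sup>2))"
      using t upper[of d h] max_quadratic_ge[of g h s B]
        max_linear_ge[of "\<lambda>h. g h + B h *v s" h d]
      by (intro add_mono mult_left_mono) auto
    finally have "t * 0 \<le> t * (?r + t * (b / 2 * (norm d)\<^sup>2))"
      by (simp add: algebra_simps)
    then show "0 \<le> ?r + t * (b / 2 * (norm d)\<^sup>2)" using t by (simp only: mult_le_cancel_left_pos)
  qed
  moreover obtain h where "?r = (g h + B h *v s) \<bullet> d"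
    using max_linear_attained[of "\<lambda>h. g h + B h *v s" d] by blast
  ultimately show ?thesis by auto
qed

text \<open>\<open>g h + B h *v s\<close> predicts the gradients after the step \<open>s\<close>,
  and some prediction has nonnegative slope; \<open>c\<close> bounds the prediction error.\<close>

lemma next_slope_ge:
  assumes "\<And>h. norm (g' h - g h - B h *v s) \<le> c"
  shows "- (c * norm d) \<le> max_linear g' d"
proof -
  obtain h where h: "0 \<le> (g h + B h *v s) \<bullet> d" using stationarity by blast
  have "\<bar>(g' h - g h - B h *v s) \<bullet> d\<bar> \<le> c * norm d"
    by (rule order_trans[OF Cauchy_Schwarz_ineq2]) (intro mult_right_mono assms norm_ge_zero)
  then have "- (c * norm d) \<le> g' h \<bullet> d"
    using h by (simp add: inner_diff_left inner_left_distrib abs_le_iff)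
  also have "\<dots> \<le> max_linear g' d" by (rule max_linear_ge)
  finally show ?thesis .
qed

end

section \<open>Steepest descent as the model with identity matrices\<close>

abbreviation steepest :: "('m::finite \<Rightarrow> real^'n) \<Rightarrow> real^'n" where
  "steepest g \<equiv> the_minimizer (max_quadratic g (\<lambda>_. mat 1))"

lemma max_quadratic_mat_1: "max_quadratic g (\<lambda>_. mat 1) d = max_linear g d + (1/2) * (norm d)\<^sup>2"
  unfolding max_quadratic_def max_linear_def
  by (simp add: Max_add_commute power2_norm_eq_inner)

interpretation steepest: strongly_convex_model g "\<lambda>_. mat 1" 1 1
  rewrites "strongly_convex_model.s g (\<lambda>_. mat 1) = steepest g"
  for g :: "'m::finite \<Rightarrow> real^'n"
proof -
  show *: "strongly_convex_model (\<lambda>_::'m. mat 1 :: real^'n^'n) 1 1"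
    by unfold_locales (auto simp: transpose_mat power2_norm_eq_inner)
  show "strongly_convex_model.s g (\<lambda>_. mat 1) = steepest g"
    by (rule strongly_convex_model.s_def[OF *])
qed

text \<open>With unchanged gradients the prediction error in \<open>next_slope_ge\<close> is the
  direction itself, up to sign.\<close>

lemma slope_ge_steepest: "- (norm (steepest g) * norm d) \<le> max_linear g d"
  by (rule steepest.next_slope_ge[of g g]) simp

text \<open>\<open>slope_s_ge\<close> gives the upper bound, \<open>slope_ge_steepest\<close> at the
  direction itself the lower one.\<close>

lemma slope_steepest: "max_linear g (steepest g) = - (norm (steepest g))\<^sup>2"
  using steepest.slope_s_ge[of g] slope_ge_steepest[of g "steepest g"]
  by (simp add: max_quadratic_mat_1 power2_eq_square)

text \<open>Testing with \<open>d = steepest g\<close> turns near-criticality into smallness of the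
  steepest descent direction.\<close>

lemma norm_steepest_le:
  assumes "\<And>d. - (c * norm d) \<le> max_linear g d"
    and "0 \<le> c"
  shows "norm (steepest g) \<le> c"
proof -
  have "norm (steepest g) * norm (steepest g) \<le> c * norm (steepest g)"
    using assms(1)[of "steepest g"] by (simp add: slope_steepest power2_eq_square)
  then show ?thesis using \<open>0 \<le> c\<close> by (cases "steepest g = 0") auto
qed

context strongly_convex_model
begin

text \<open>The slope of \<open>s\<close> is at most \<open>- a * (norm s)\<^sup>2\<close> and at
  least \<open>- (norm (steepest g) * norm s)\<close>.\<close>

lemma norm_s_le: "a * norm s \<le> norm (steepest g)"
proof -
  have "norm s * (a * norm s) \<le> norm s * norm (steepest g)"
    using slope_ge_steepest[of g s] slope_s_le q_s_le by (simp add: power2_eq_square mult_ac)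
  then show ?thesis by (cases "s = 0") auto
qed

lemma slope_s_le_steepest: "max_linear g s \<le> - ((norm (steepest g))\<^sup>2 / (2 * b))"
proof -
  let ?v = "steepest g"
  \<comment> \<open>The factor \<open>1 / b\<close> minimizes over \<open>t\<close> the upper
    estimate \<open>(b * t\<^sup>2 / 2 - t) * (norm ?v)\<^sup>2\<close> of
    \<open>q (t *\<^sub>R ?v)\<close>.\<close>
  obtain h where h: "q (?v /\<^sub>R b) = g h \<bullet> (?v /\<^sub>R b) + (1/2) * ((?v /\<^sub>R b) \<bullet> (B h *v (?v /\<^sub>R b)))"
    using max_quadratic_attained by blast
  have "q s \<le> q (?v /\<^sub>R b)" by (rule s_minimal)
  also have "\<dots> = (g h \<bullet> ?v) / b + (1/2) * (?v \<bullet> (B h *v ?v)) / b\<^sup>2"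
    unfolding h by (simp add: matrix_vector_mult_scaleR power2_eq_square divide_simps)
  also have "\<dots> \<le> - (norm ?v)\<^sup>2 / b + (1/2) * (b * (norm ?v)\<^sup>2) / b\<^sup>2"
    using b_pos upper[of ?v h] max_linear_ge[of g h ?v]
    by (intro add_mono divide_right_mono) (auto simp: slope_steepest)
  also have "\<dots> = - ((norm ?v)\<^sup>2 / (2 * b))"
    using b_pos by (simp add: power2_eq_square field_simps)
  finally have "q s \<le> - ((norm ?v)\<^sup>2 / (2 * b))" .
  moreover have "0 \<le> a / 2 * (norm s)\<^sup>2" using a_pos by simp
  ultimately show ?thesis using slope_s_le by linarith
qed

end

section \<open>Convergence rates from step lengths\<close>

text \<open>The distance from \<open>x k\<close> plus twice the current step never increases. This
  bounds all later displacement by twice the step at \<open>k\<close>, which gives both the Cauchy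
  property and the error bound.\<close>

lemma halving_steps_converge:
  fixes x :: "nat \<Rightarrow> 'a::complete_space"
  assumes halving: "\<And>k. k \<ge> K \<Longrightarrow> dist (x (Suc (Suc k))) (x (Suc k)) \<le> dist (x (Suc k)) (x k) / 2"
  shows "\<exists>l. x \<longlonglongrightarrow> l \<and> (\<forall>k\<ge>K. dist (x k) l \<le> 2 * dist (x (Suc k)) (x k))"
proof -
  define \<delta> where "\<delta> k = dist (x (Suc k)) (x k)" for k
  have tail: "dist (x (k + j)) (x k) + 2 * \<delta> (k + j) \<le> 2 * \<delta> k" if "k \<ge> K" for k j
  proof (induction j)
    case (Suc j)
    have "dist (x (k + Suc j)) (x k) \<le> dist (x (k + j)) (x k) + \<delta> (k + j)"
      unfolding \<delta>_def using dist_triangle[of "x (k + Suc j)" "x k" "x (k + j)"] by simp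
    moreover have "\<delta> (k + Suc j) \<le> \<delta> (k + j) / 2"
      unfolding \<delta>_def using halving[of "k + j"] that by simp
    ultimately show ?case using Suc by linarith
  qed simp
  have geom: "\<delta> (K + j) \<le> \<delta> K * (1/2) ^ j" for j
  proof (induction j)
    case (Suc j)
    have "\<delta> (K + Suc j) \<le> \<delta> (K + j) / 2" unfolding \<delta>_def using halving[of "K + j"] by simp
    with Suc show ?case by simp
  qed simp
  have "Cauchy x"
  proof (rule metric_CauchyI)
    fix e :: real assume "e > 0"
    \<comment> \<open>The factor 4 yields \<open>2 * \<delta> (K + j) < e / 2\<close>, as
      \<open>near\<close> requires.\<close>
    have "(\<lambda>j. 4 * (\<delta> K * (1/2) ^ j)) \<longlonglongrightarrow> 4 * (\<delta> K * 0)"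
      by (intro tendsto_intros LIMSEQ_power_zero) simp
    then have "eventually (\<lambda>j. 4 * (\<delta> K * (1/2) ^ j) < e) sequentially"
      using \<open>e > 0\<close> by (intro order_tendstoD(2)[where y = "4 * (\<delta> K * 0)"]) auto
    then obtain j where j: "4 * (\<delta> K * (1/2) ^ j) < e" using eventually_happens'[OF sequentially_bot] by blast
    have near: "dist (x m) (x (K + j)) < e / 2" if "m \<ge> K + j" for m
    proof -
      have "dist (x m) (x (K + j)) \<le> 2 * \<delta> (K + j)"
        using tail[of "K + j" "m - (K + j)"] that by (simp add: \<delta>_def) (smt (verit) zero_le_dist)
      then show ?thesis using geom[of j] j by linarith
    qed
    show "\<exists>M. \<forall>m\<ge>M. \<forall>n\<ge>M. dist (x m) (x n) < e"
      using near dist_triangle_half_l by (metis dist_commute)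
  qed
  then obtain l where l: "x \<longlonglongrightarrow> l" using Cauchy_convergent convergent_def by blast
  have "dist (x k) l \<le> 2 * \<delta> k" if "k \<ge> K" for k
  proof -
    have "(\<lambda>j. dist (x k) (x (j + k))) \<longlonglongrightarrow> dist (x k) l"
      by (intro tendsto_intros LIMSEQ_ignore_initial_segment l)
    moreover have "dist (x k) (x (j + k)) \<le> 2 * \<delta> k" for j
      using tail[OF that, of j] by (simp add: \<delta>_def dist_commute add.commute) (smt (verit) zero_le_dist)
    ultimately show ?thesis by (intro LIMSEQ_le_const2) auto
  qed
  with l show ?thesis unfolding \<delta>_def by blast
qed

text \<open>An error is at most twice its step, and a step at most the sum of two consecutive
  errors, so small step ratios force small error ratios.\<close>

lemma converges_superlinearly_stepsI:
  fixes x :: "nat \<Rightarrow> 'a::metric_space"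
  assumes lim: "x \<longlonglongrightarrow> l"
    and err: "eventually (\<lambda>k. dist (x k) l \<le> 2 * dist (x (Suc k)) (x k)) sequentially"
    and steps: "\<And>c. c > 0 \<Longrightarrow> eventually (\<lambda>k. dist (x (Suc (Suc k))) (x (Suc k)) \<le> c * dist (x (Suc k)) (x k)) sequentially"
  shows "converges_superlinearly x l"
proof -
  have "(\<lambda>k. dist (x (Suc k)) l) \<in> o(\<lambda>k. dist (x k) l)"
  proof (rule landau_o.smallI)
    fix c :: real assume "c > 0"
    \<comment> \<open>The entry \<open>1/4\<close> leaves half of the new error after absorption on
      the left; \<open>c/4\<close> makes the factor of the old error at most
      \<open>c/2\<close>.\<close>
    define c' where "c' = min (1/4) (c/4)"
    have c': "c' > 0" "c' \<le> 1/4" "c' \<le> c/4" using \<open>c > 0\<close> by (auto simp: c'_def)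
    have err': "eventually (\<lambda>k. dist (x (Suc k)) l \<le> 2 * dist (x (Suc (Suc k))) (x (Suc k))) sequentially"
      using err by (simp add: eventually_sequentially_Suc[of "\<lambda>k. dist (x k) l \<le> 2 * dist (x (Suc k)) (x k)"])
    show "eventually (\<lambda>k. norm (dist (x (Suc k)) l) \<le> c * norm (dist (x k) l)) sequentially"
      using steps[OF c'(1)] err'
    proof eventually_elim
      case (elim k)
      have "dist (x (Suc k)) l \<le> 2 * (c' * dist (x (Suc k)) (x k))" using elim by linarith
      also have "\<dots> \<le> 2 * (c' * (dist (x (Suc k)) l + dist (x k) l))"
        using c' by (intro mult_left_mono dist_triangle2) auto
      finally have "(1 - 2 * c') * dist (x (Suc k)) l \<le> 2 * c' * dist (x k) l"
        by (simp add: algebra_simps)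
      moreover have "1/2 * dist (x (Suc k)) l \<le> (1 - 2 * c') * dist (x (Suc k)) l"
        using c' by (intro mult_right_mono) auto
      moreover have "2 * c' * dist (x k) l \<le> c/2 * dist (x k) l"
        using c' by (intro mult_right_mono) auto
      ultimately show ?case by simp
    qed
  qed
  with lim show ?thesis by (simp add: converges_superlinearly_def)
qed

lemma converges_quadratically_stepsI:
  fixes x :: "nat \<Rightarrow> 'a::metric_space"
  assumes superlinear: "converges_superlinearly x l"
    and err: "eventually (\<lambda>k. dist (x k) l \<le> 2 * dist (x (Suc k)) (x k)) sequentially"
    and steps: "eventually (\<lambda>k. dist (x (Suc (Suc k))) (x (Suc k)) \<le> C * (dist (x (Suc k)) (x k))\<^sup>2) sequentially"
    and "0 \<le> C"
  shows "converges_quadratically x l"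
proof -
  have err': "eventually (\<lambda>k. dist (x (Suc k)) l \<le> 2 * dist (x (Suc (Suc k))) (x (Suc k))) sequentially"
    using err by (simp add: eventually_sequentially_Suc[of "\<lambda>k. dist (x k) l \<le> 2 * dist (x (Suc k)) (x k)"])
  \<comment> \<open>Superlinear convergence makes errors eventually nonincreasing, so a step is at
    most twice the old error. The 8 below is 2 from \<open>err'\<close> times the square of this
    2.\<close>
  have "eventually (\<lambda>k. norm (dist (x (Suc k)) l) \<le> 1 * norm (dist (x k) l)) sequentially"
    using superlinear unfolding converges_superlinearly_def by (intro landau_o.smallD) auto
  with steps err' have "eventually (\<lambda>k. norm (dist (x (Suc k)) l) \<le> 8 * C * norm ((dist (x k) l)\<^sup>2)) sequentially"
  proof eventually_elim
    case (elim k)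
    have "dist (x (Suc k)) (x k) \<le> 2 * dist (x k) l"
      using elim(3) dist_triangle2[of "x (Suc k)" "x k" l] by simp
    then have "(dist (x (Suc k)) (x k))\<^sup>2 \<le> (2 * dist (x k) l)\<^sup>2" by (intro power_mono) auto
    then have "C * (dist (x (Suc k)) (x k))\<^sup>2 \<le> C * (2 * dist (x k) l)\<^sup>2"
      using \<open>0 \<le> C\<close> by (rule mult_left_mono)
    then show ?case using elim by (simp add: power_mult_distrib)
  qed
  then have "(\<lambda>k. dist (x (Suc k)) l) \<in> O(\<lambda>k. (dist (x k) l)\<^sup>2)" by (rule bigoI)
  with superlinear show ?thesis
    by (simp add: converges_superlinearly_def converges_quadratically_def)
qed

section \<open>Newton directions for vector optimization\<close>

lemma max_slope_eq: "max_slope F x = max_linear (\<lambda>h. grad F h x)"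
  by (simp add: fun_eq_iff max_slope_def max_linear_def)

lemma quadratic_model_eq: "quadratic_model F B x = max_quadratic (\<lambda>h. grad F h x) B"
  by (simp add: fun_eq_iff quadratic_model_def max_quadratic_def)

lemma descent_model_UNIV_eq:
  "descent_model F UNIV x = max_quadratic (\<lambda>h. grad F h x) (\<lambda>_. mat 1)"
  by (simp add: fun_eq_iff descent_model_def max_quadratic_mat_1 max_linear_def)

lemma steepest_direction_UNIV_eq: "steepest_direction F UNIV x = steepest (\<lambda>h. grad F h x)"
  by (simp add: steepest_direction_def descent_model_UNIV_eq)

text \<open>Consequently \<open>theta\<close> is negative exactly when the steepest descent
  direction is nonzero.\<close>

lemma theta_UNIV: "theta F UNIV x = - (norm (steepest_direction F UNIV x))\<^sup>2 / 2"
  by (simp add: theta_def descent_model_UNIV_eq steepest_direction_UNIV_eq max_quadratic_mat_1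
      slope_steepest)

lemma armijo_step_eq_1:
  assumes "fd_alpha0 P = 1" "0 < fd_delta P" "fd_delta P < 1"
    and "\<And>h. F (x + d) $ h \<le> F x $ h + fd_gamma P * max_slope F x d"
  shows "armijo_step F P x d = 1"
  unfolding armijo_step_def
proof (rule Greatest_equality)
  show "\<exists>h. 1 = fd_alpha0 P * fd_delta P ^ h \<and>
      F (x + 1 *\<^sub>R d) \<le> F x + (fd_gamma P * 1 * max_slope F x d) *\<^sub>R 1"
    using assms by (intro exI[of _ 0]) (simp add: less_eq_vec_def)
  show "a \<le> 1" if "\<exists>h. a = fd_alpha0 P * fd_delta P ^ h \<and>
      F (x + a *\<^sub>R d) \<le> F x + (fd_gamma P * a * max_slope F x d) *\<^sub>R 1" for a
    using that assms by (auto intro: power_le_one)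
qed

locale C2_objective =
  fixes F :: "real^'n \<Rightarrow> real^'m"
  assumes C2: "twice_continuously_differentiable (\<lambda>y. F y $ h)"
begin

lemmas has_derivative_grad = has_derivative_hessian_C2[OF C2, folded grad_def hess_def]
lemmas hess_sym = hessian_symmetric[OF C2, folded hess_def]
lemmas taylor = taylor_second_order[OF C2, folded grad_def hess_def]
lemmas grad_error = gradient_linearization_error[OF C2, folded grad_def hess_def]

lemma eventually_hess_near:
  assumes "e > 0"
  shows "eventually (\<lambda>y. \<forall>h. norm (hess F h y - hess F h x) < e) (nhds x)"
proof (rule eventually_all_finite)
  show "eventually (\<lambda>y. norm (hess F h y - hess F h x) < e) (nhds x)" for h
    using continuous_hessian_C2[OF C2[of h] assms, of x]
    by (simp add: eventually_nhds_metric hess_def)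
qed

lemma tendsto_grad: "(grad F h \<longlongrightarrow> grad F h x) (nhds x)"
  using has_derivative_continuous[OF has_derivative_grad, of x h]
  by (simp add: isCont_def tendsto_nhds_iff)

lemma eventually_grad_near:
  assumes "e > 0"
  shows "eventually (\<lambda>y. \<forall>h. norm (grad F h y - grad F h x) < e) (nhds x)"
proof (rule eventually_all_finite)
  show "eventually (\<lambda>y. norm (grad F h y - grad F h x) < e) (nhds x)" for h
    using tendstoD[OF tendsto_grad assms] by (simp add: dist_norm)
qed

text \<open>A negative maximal slope would make all finitely many objectives decrease for small
  positive steps, putting dominating points into every neighborhood.\<close>

lemma local_Pareto_imp_critical:
  assumes "local_Pareto_optimal F x"
  shows "0 \<le> max_slope F x d"
proof (rule ccontr)
  assume "\<not> 0 \<le> max_slope F x d"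
  then have neg: "grad F h x \<bullet> d < 0" for h
    using max_linear_ge[of "\<lambda>h. grad F h x" h d] by (simp add: max_slope_eq)
  obtain U where U: "open U" "x \<in> U" "\<And>y. y \<in> U \<Longrightarrow> \<not> dominates F y x"
    using assms by (auto simp: local_Pareto_optimal_def)
  have "eventually (\<lambda>t. \<forall>h. F (x + t *\<^sub>R d) $ h < F x $ h) (at_right 0)"
  proof (rule eventually_all_finite)
    fix h
    have "DERIV (\<lambda>t. F (x + t *\<^sub>R d) $ h) 0 :> grad F h x \<bullet> d"
      using DERIV_along_line[OF C2[of h], of x d 0] by (simp add: grad_def)
    from DERIV_neg_dec_right[OF this neg] obtain e where
      "e > 0" "\<And>t. 0 < t \<Longrightarrow> t < e \<Longrightarrow> F (x + t *\<^sub>R d) $ h < F x $ h" by auto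
    then show "eventually (\<lambda>t. F (x + t *\<^sub>R d) $ h < F x $ h) (at_right 0)"
      unfolding eventually_at_right_field by auto
  qed
  moreover have "((\<lambda>t. x + t *\<^sub>R d) \<longlongrightarrow> x + 0 *\<^sub>R d) (at_right 0)"
    by (intro tendsto_intros)
  then have "eventually (\<lambda>t. x + t *\<^sub>R d \<in> U) (at_right 0)"
    using U by (intro topological_tendstoD) auto
  ultimately have "eventually (\<lambda>t. \<exists>y\<in>U. dominates F y x) (at_right (0::real))"
  proof eventually_elim
    case (elim t)
    then show ?case
      unfolding dominates_def less_eq_vec_def by (metis less_imp_le less_irrefl)
  qed
  then show False using U eventually_happens'[OF trivial_limit_at_right_real] by blast
qed

text \<open>For fixed \<open>d\<close>, convergence of the gradients suffices; continuity of the
  steepest descent direction does not enter.\<close>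

lemma critical_limit:
  assumes lim: "x \<longlonglongrightarrow> l" and c: "c \<longlonglongrightarrow> 0"
    and ev: "eventually (\<lambda>k. - (c k * norm d) \<le> max_slope F (x k) d) sequentially"
  shows "0 \<le> max_slope F l d"
proof (rule field_le_epsilon)
  fix e :: real assume "e > 0"
  define e' where "e' = e / (norm d + 1)"
  have "norm d + 1 > 0" by (simp add: add_nonneg_pos)
  then have "e' > 0" using \<open>e > 0\<close> by (simp add: e'_def)
  have ev1: "eventually (\<lambda>k. \<forall>h. norm (grad F h (x k) - grad F h l) < e') sequentially"
    using eventually_grad_near[OF \<open>e' > 0\<close>] lim
    by (rule eventually_compose_filterlim)
  have "(\<lambda>k. - (c k * norm d)) \<longlonglongrightarrow> - (0 * norm d)" by (intro tendsto_intros c)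
  moreover have "eventually (\<lambda>k. - (c k * norm d) \<le> max_slope F l d + e) sequentially"
    using ev ev1
  proof eventually_elim
    case (elim k)
    obtain h where "max_slope F (x k) d = grad F h (x k) \<bullet> d"
      using max_linear_attained[of "\<lambda>h. grad F h (x k)" d] by (auto simp: max_slope_eq)
    moreover have "(grad F h (x k) - grad F h l) \<bullet> d \<le> e' * norm d"
      using Cauchy_Schwarz_ineq2[of "grad F h (x k) - grad F h l" d] elim(2)[rule_format, of h]
        mult_right_mono[of "norm (grad F h (x k) - grad F h l)" e' "norm d"] by simp
    moreover have "e' * norm d \<le> e' * (norm d + 1)" using \<open>e' > 0\<close> by simp
    moreover have "e' * (norm d + 1) = e" using \<open>norm d + 1 > 0\<close> by (simp add: e'_def)
    moreover have "grad F h l \<bullet> d \<le> max_slope F l d"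
      unfolding max_slope_eq by (rule max_linear_ge)
    ultimately show ?case using elim(1) by (simp add: inner_diff_left)
  qed
  ultimately show "0 \<le> max_slope F l d + e"
    by (intro tendsto_upperbound[where F = sequentially]) auto
qed

end

section \<open>Newton steps in a convex region with uniform curvature bounds\<close>

locale newton_region = C2_objective F for F :: "real^'n \<Rightarrow> real^'m" +
  fixes N :: "(real^'n) set" and a b e :: real
  assumes N_open: "open N" and N_convex: "convex N"
    and a_pos: "0 < a" and b_pos: "0 < b"
    and hess_lower: "x \<in> N \<Longrightarrow> a * (norm d)\<^sup>2 \<le> d \<bullet> (hess F h x *v d)"
    and hess_upper: "x \<in> N \<Longrightarrow> d \<bullet> (hess F h x *v d) \<le> b * (norm d)\<^sup>2"
    and hess_variation: "x \<in> N \<Longrightarrow> y \<in> N \<Longrightarrow> norm (hess F h y - hess F h x) \<le> e"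
begin

context
  fixes x assumes x: "x \<in> N"
begin

interpretation model: strongly_convex_model "\<lambda>h. grad F h x" "\<lambda>h. hess F h x" a b
  rewrites "strongly_convex_model.s (\<lambda>h. grad F h x) (\<lambda>h. hess F h x) = newton_direction F x"
proof -
  show *: "strongly_convex_model (\<lambda>h. hess F h x) a b"
    using x hess_lower hess_upper a_pos b_pos hess_sym by unfold_locales auto
  show "strongly_convex_model.s (\<lambda>h. grad F h x) (\<lambda>h. hess F h x) = newton_direction F x"
    by (simp add: strongly_convex_model.s_def[OF *] newton_direction_def quadratic_model_eq)
qed

lemma norm_newton_le: "a * norm (newton_direction F x) \<le> norm (steepest_direction F UNIV x)"
  using model.norm_s_le by (simp add: steepest_direction_UNIV_eq)

lemma slope_newton_le:
  "max_slope F x (newton_direction F x) \<le> - ((norm (steepest_direction F UNIV x))\<^sup>2 / (2 * b))"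
  using model.slope_s_le_steepest by (simp add: steepest_direction_UNIV_eq max_slope_eq)

lemma segment_in_N:
  assumes "x + s \<in> N" "0 \<le> t" "t \<le> 1"
  shows "x + t *\<^sub>R s \<in> N"
proof -
  have "(1 - t) *\<^sub>R x + t *\<^sub>R (x + s) \<in> N" using assms x by (intro convexD_alt[OF N_convex]) auto
  then show ?thesis by (simp add: algebra_simps)
qed

text \<open>Taylor's formula bounds each increase by the model value plus
  \<open>e / 2 * (norm s)\<^sup>2\<close>, \<open>s\<close> being the Newton direction. A fraction
  \<open>1 - 2 * \<gamma>\<close> of the model value absorbs the Taylor error; the rest is at most
  \<gamma> times the slope.\<close>

lemma newton_sufficient_decrease:
  assumes N': "x + newton_direction F x \<in> N"
    and \<gamma>: "0 < \<gamma>" "\<gamma> < 1/2" "e \<le> (1 - 2 * \<gamma>) * a"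
  shows "F (x + newton_direction F x) $ h \<le> F x $ h + \<gamma> * max_slope F x (newton_direction F x)"
proof -
  let ?s = "newton_direction F x"
  obtain t where t: "0 < t" "t < 1"
    "F (x + ?s) $ h = F x $ h + grad F h x \<bullet> ?s + (1/2) * (?s \<bullet> (hess F h (x + t *\<^sub>R ?s) *v ?s))"
    using taylor by blast
  have "\<bar>?s \<bullet> (hess F h (x + t *\<^sub>R ?s) *v ?s) - ?s \<bullet> (hess F h x *v ?s)\<bar> \<le> e * (norm ?s)\<^sup>2"
    using segment_in_N[OF N', of t] t x
    by (intro order_trans[OF quadratic_form_diff_le] mult_right_mono hess_variation) auto
  then have 1: "F (x + ?s) $ h \<le> F x $ h + model.q ?s + e / 2 * (norm ?s)\<^sup>2"
    unfolding t(3)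
    using max_quadratic_ge[of "\<lambda>h. grad F h x" h ?s "\<lambda>h. hess F h x"] by simp
  have 2: "e * (norm ?s)\<^sup>2 \<le> (1 - 2 * \<gamma>) * a * (norm ?s)\<^sup>2"
    using \<gamma> by (intro mult_right_mono) auto
  have 3: "(1 - 2 * \<gamma>) * model.q ?s \<le> (1 - 2 * \<gamma>) * - (a / 2 * (norm ?s)\<^sup>2)"
    using \<gamma> by (intro mult_left_mono model.q_s_le) auto
  have 4: "\<gamma> * (2 * model.q ?s) \<le> \<gamma> * max_slope F x ?s"
    unfolding max_slope_eq using \<gamma> by (intro mult_left_mono model.slope_s_ge) auto
  have "model.q ?s + e / 2 * (norm ?s)\<^sup>2 \<le> \<gamma> * max_slope F x ?s"
    using 2 3 4 by (simp add: field_simps)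
  with 1 show ?thesis by linarith
qed

lemma slope_after_newton_step:
  assumes "\<And>h t. 0 \<le> t \<Longrightarrow> t \<le> 1 \<Longrightarrow> norm (hess F h (x + t *\<^sub>R newton_direction F x) - hess F h x) \<le> c"
  shows "- (c * norm (newton_direction F x) * norm d) \<le> max_slope F (x + newton_direction F x) d"
  unfolding max_slope_eq by (rule model.next_slope_ge) (rule grad_error[OF assms])

lemma steepest_after_newton_step:
  assumes "\<And>h t. 0 \<le> t \<Longrightarrow> t \<le> 1 \<Longrightarrow> norm (hess F h (x + t *\<^sub>R newton_direction F x) - hess F h x) \<le> c"
  shows "norm (steepest_direction F UNIV (x + newton_direction F x)) \<le> c * norm (newton_direction F x)"
  unfolding steepest_direction_UNIV_eq
proof (rule norm_steepest_le)
  show "- (c * norm (newton_direction F x) * norm d)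
      \<le> max_linear (\<lambda>h. grad F h (x + newton_direction F x)) d" for d
    using slope_after_newton_step[OF assms, of d] by (simp add: max_slope_eq)
  have "0 \<le> c" using assms[of 0] norm_ge_zero order_trans by fastforce
  then show "0 \<le> c * norm (newton_direction F x)" by simp
qed

text \<open>Towards any other point of \<open>N\<close>, the objective with the largest slope starts
  with nonnegative slope and has positive curvature, so it strictly increases.\<close>

lemma critical_imp_local_Pareto:
  assumes crit: "\<And>d. 0 \<le> max_slope F x d"
  shows "local_Pareto_optimal F x"
  unfolding local_Pareto_optimal_def
proof (intro exI conjI ballI)
  show "open N" "x \<in> N" using N_open x by auto
  fix y assume "y \<in> N"
  show "\<not> dominates F y x"
  proof
    assume dom: "dominates F y x"
    let ?d = "y - x"
    have "?d \<noteq> 0" using dom by (auto simp: dominates_def)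
    obtain h where h: "max_slope F x ?d = grad F h x \<bullet> ?d"
      using max_linear_attained[of "\<lambda>h. grad F h x" ?d] by (auto simp: max_slope_eq)
    obtain t where t: "0 < t" "t < 1"
      "F (x + ?d) $ h = F x $ h + grad F h x \<bullet> ?d + (1/2) * (?d \<bullet> (hess F h (x + t *\<^sub>R ?d) *v ?d))"
      using taylor by blast
    have "x + t *\<^sub>R ?d \<in> N" using segment_in_N[of ?d t] t \<open>y \<in> N\<close> by simp
    then have "a * (norm ?d)\<^sup>2 \<le> ?d \<bullet> (hess F h (x + t *\<^sub>R ?d) *v ?d)" by (rule hess_lower)
    moreover have "0 < a * (norm ?d)\<^sup>2" using a_pos \<open>?d \<noteq> 0\<close> by simp
    ultimately have "F x $ h < F y $ h" using t(3) crit[of ?d] h by simp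
    then show False using dom by (auto simp: dominates_def less_eq_vec_def not_le[symmetric])
  qed
qed

lemma hessian_shift_eq_0: "hessian_shift \<kappa> (hess F h x) = 0"
  using le_lambda_min[OF hess_sym, of a h x] hess_lower[OF x] a_pos
  by (force simp: hessian_shift_def)

lemma modified_newton_eq: "modified_newton_direction \<kappa> F x = newton_direction F x"
proof -
  have "mat 0 = (0 :: real^'n^'n)" by (simp add: mat_def vec_eq_iff)
  then show ?thesis
    by (simp add: modified_newton_direction_def newton_direction_def hessian_shift_eq_0)
qed

context
  fixes P :: fd_params
  assumes \<Gamma>: "fd_Gamma1 P \<le> 1 / (2 * b)" "1 / a \<le> fd_Gamma2 P"
begin

lemma accept_newton: "accept_direction F P x (newton_direction F x)"
  unfolding accept_direction_def
proof
  let ?v = "norm (steepest_direction F UNIV x)"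
  have "fd_Gamma1 P * ?v\<^sup>2 \<le> 1 / (2 * b) * ?v\<^sup>2" using \<Gamma> by (intro mult_right_mono) auto
  then show "max_slope F x (newton_direction F x) \<le> - fd_Gamma1 P * ?v\<^sup>2"
    using slope_newton_le by simp
  have "norm (newton_direction F x) \<le> 1 / a * ?v"
    using norm_newton_le a_pos by (simp add: field_simps)
  also have "\<dots> \<le> fd_Gamma2 P * ?v" using \<Gamma> by (intro mult_right_mono) auto
  finally show "norm (newton_direction F x) \<le> fd_Gamma2 P * ?v" .
qed

text \<open>If \<open>theta\<close> is not negative, the algorithm stays put, but then the Newton
  direction is zero too. So only the step length needs a guard.\<close>

lemma refinement_newton:
  assumes N': "x + newton_direction F x \<in> N"
    and "valid_params P" "fd_alpha0 P = 1" "fd_sigma P k = 0" "fd_gamma P < 1/2"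
    and "e \<le> (1 - 2 * fd_gamma P) * a"
    and vD: "vD k x = newton_direction F x"
  shows "refinement_direction F P vD k x = newton_direction F x"
    and "theta F UNIV x < 0 \<Longrightarrow> refinement_step F P vD k x = 1"
    and "refinement_point F P vD k x = x + newton_direction F x"
proof -
  have critical: "steepest_direction F UNIV x = 0 \<and> newton_direction F x = 0" if "\<not> theta F UNIV x < 0"
  proof -
    have "steepest_direction F UNIV x = 0" using that by (simp add: theta_UNIV)
    then show ?thesis using norm_newton_le a_pos by (simp add: mult_le_0_iff)
  qed
  show dir: "refinement_direction F P vD k x = newton_direction F x"
    using critical accept_newton assms by (simp add: refinement_direction_def)
  show step: "refinement_step F P vD k x = 1" if "theta F UNIV x < 0"
  proof -
    have "armijo_step F P x (newton_direction F x) = 1"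
      using assms by (intro armijo_step_eq_1 newton_sufficient_decrease) (auto simp: valid_params_def)
    then show ?thesis using that assms dir by (simp add: refinement_step_def)
  qed
  show "refinement_point F P vD k x = x + newton_direction F x"
    using step critical by (cases "theta F UNIV x < 0") (auto simp: refinement_point_def dir)
qed

end

end

end

text \<open>The unit step is claimed only where \<open>theta\<close> is negative: at a critical
  iterate the algorithm sets the step to 0. The neighborhood and radii are chosen before
  \<open>K\<close>.\<close>

theorem proposition5p9:
  fixes F :: "real^'n \<Rightarrow> real^'m"
    and P :: fd_params
    and vD :: "nat \<Rightarrow> real^'n \<Rightarrow> real^'n"
    and X :: "nat \<Rightarrow> (real^'n) set"
    and L :: "nat \<Rightarrow> real^'n \<Rightarrow> (real^'n) set option"
    and x :: "nat \<Rightarrow> real^'n"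
    and xbar :: "real^'n"
    and \<kappa> \<omega> :: real
  assumes C2: "\<forall>h. twice_continuously_differentiable (\<lambda>y. F y $ h)"
    and run: "front_descent_run F P vD X L"
    and seq: "refining_linked_sequence F P vD X L x"
    and sigma: "\<forall>k. fd_sigma P k = 0"
    and alpha0: "fd_alpha0 P = 1"
    and gamma: "0 < fd_gamma P" "fd_gamma P < 1/2"
    and kappa: "\<kappa> > 0"
    and tentative: "\<forall>k. vD k (x k) = modified_newton_direction \<kappa> F (x k)"
    and pareto: "local_Pareto_optimal F xbar"
    and posdef: "\<forall>h. positive_definite (hess F h xbar)"
    and omega: "0 < \<omega>" "\<omega> < 1"
    and Gamma1: "fd_Gamma1 P \<le>
      \<omega>^3 / 2 * ((MIN h. lambda_min (hess F h xbar)) / (MAX h. (lambda_max (hess F h xbar))\<^sup>2))"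
    and Gamma2: "fd_Gamma2 P \<ge> 1 / (\<omega> * (MIN h. lambda_min (hess F h xbar)))"
  shows "\<exists>N \<rho> r. open N \<and> xbar \<in> N \<and> 0 < \<rho> \<and> \<rho> \<le> r \<and> ball xbar \<rho> \<subset> N \<and>
    (\<forall>K. x K \<in> ball xbar \<rho> \<and> (\<forall>k\<ge>K. x (Suc k) = refinement_point F P vD k (x k)) \<longrightarrow>
       (\<forall>k\<ge>K.
          (\<forall>h. hessian_shift \<kappa> (hess F h (x k)) = 0) \<and>
          modified_newton_direction \<kappa> F (x k) = newton_direction F (x k) \<and>
          refinement_direction F P vD k (x k) = modified_newton_direction \<kappa> F (x k) \<and>
          accept_direction F P (x k) (modified_newton_direction \<kappa> F (x k)) \<and>
          (theta F UNIV (x k) < 0 \<longrightarrow> refinement_step F P vD k (x k) = 1) \<and>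
          x k \<in> ball (x K) r \<and> ball (x K) r \<subset> N) \<and>
       (\<exists>xstar \<in> ball (x K) r.
          local_Pareto_optimal F xstar \<and>
          converges_superlinearly x xstar \<and>
          ((\<forall>h. \<exists>C. C-lipschitz_on N (hess F h)) \<longrightarrow> converges_quadratically x xstar)))"
proof -
  interpret C2_objective F using C2 by unfold_locales auto

  \<comment> \<open>Spectral bounds at \<open>xbar\<close> and curvature constants\<close>
  define lam where "lam = (MIN h. lambda_min (hess F h xbar))"
  define M where "M = (MAX h. (lambda_max (hess F h xbar))\<^sup>2)"
  \<comment> \<open>\<open>M\<close> is a maximum of squares; its root dominates every largest
    eigenvalue.\<close>
  define Lam where "Lam = sqrt M"
  have lam_le: "lam \<le> lambda_min (hess F h xbar)" for h
    unfolding lam_def by (rule Min_le) auto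
  have "lam \<in> range (\<lambda>h. lambda_min (hess F h xbar))"
    unfolding lam_def by (rule Min_in) auto
  then have lam_pos: "0 < lam" using lambda_min_pos[OF hess_sym] posdef by auto
  have Lam_ge: "lambda_max (hess F h xbar) \<le> Lam" for h
    unfolding Lam_def M_def by (intro real_le_rsqrt Max_ge) auto
  have lam_le_Lam: "lam \<le> Lam"
    using lam_le Lam_ge lambda_min_le_lambda_max[OF hess_sym] order_trans by metis
  then have Lam_pos: "0 < Lam" using lam_pos by simp
  then have M_eq: "M = Lam\<^sup>2" by (simp add: Lam_def)

  \<comment> \<open>The factor \<omega> weakens both spectral bounds, leaving the slack that lets
    them survive near \<open>xbar\<close>.\<close>
  define a where "a = \<omega> * lam"
  define b where "b = Lam / \<omega>"
  have a_pos: "0 < a" and b_pos: "0 < b" using omega lam_pos Lam_pos by (auto simp: a_def b_def)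
  have \<Gamma>1: "fd_Gamma1 P \<le> 1 / (2 * b)"
  proof -
    \<comment> \<open>Multiplied by \<open>\<omega> / (2 * Lam\<^sup>2)\<close>, this compares the
      assumed bound on \<open>fd_Gamma1 P\<close> with \<open>1 / (2 * b)\<close>.\<close>
    have "\<omega>\<^sup>2 * lam \<le> 1 * Lam"
      using omega lam_pos lam_le_Lam by (intro mult_mono power_le_one) auto
    then have "\<omega> * (\<omega>\<^sup>2 * lam) / (2 * Lam\<^sup>2) \<le> \<omega> * Lam / (2 * Lam\<^sup>2)"
      using omega by (intro divide_right_mono mult_left_mono) auto
    then have "\<omega>^3 / 2 * (lam / M) \<le> 1 / (2 * b)"
      using Lam_pos by (simp add: M_eq b_def power2_eq_square power3_eq_cube mult_ac)
    then show ?thesis using Gamma1 unfolding lam_def M_def by linarith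
  qed
  have \<Gamma>2: "1 / a \<le> fd_Gamma2 P" using Gamma2 by (simp add: a_def lam_def)

  \<comment> \<open>The first two entries preserve the curvature bounds \<open>a\<close> and
    \<open>b\<close>, the third pays for the Taylor error in the Armijo test, the last makes the
    steps halve.\<close>
  define e where "e = min (min ((1 - \<omega>) * lam) (Lam / \<omega> - Lam)) (min ((1 - 2 * fd_gamma P) * a) (a / 2))"
  have "Lam < Lam / \<omega>" using omega Lam_pos by (simp add: field_simps)
  then have e_pos: "0 < e" using omega lam_pos a_pos gamma by (simp add: e_def)
  have e: "e \<le> (1 - \<omega>) * lam" "e \<le> Lam / \<omega> - Lam" "e \<le> (1 - 2 * fd_gamma P) * a" "e \<le> a / 2"
    unfolding e_def by linarith+
  \<comment> \<open>Half of \<open>e\<close>, because two Hessians in \<open>N\<close> are compared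
    through \<open>xbar\<close>.\<close>
  obtain R where R: "0 < R" "\<And>y h. dist y xbar < R \<Longrightarrow> norm (hess F h y - hess F h xbar) < e / 2"
    using eventually_hess_near[of "e / 2" xbar] e_pos by (auto simp: eventually_nhds_metric)
  define N where "N = ball xbar R"
  have near: "norm (hess F h y - hess F h xbar) < e / 2" if "y \<in> N" for h y
    using R(2) that by (simp add: N_def dist_commute)
  interpret newton_region F N a b e
  proof
    show "open N" "convex N" by (simp_all add: N_def)
    show "0 < a" "0 < b" by fact+
    fix y d h assume y: "y \<in> N"
    have pert: "\<bar>d \<bullet> (hess F h y *v d) - d \<bullet> (hess F h xbar *v d)\<bar> \<le> e * (norm d)\<^sup>2"
      using near[OF y, of h] e_pos
      by (intro order_trans[OF quadratic_form_diff_le] mult_right_mono) auto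
    have "lam * (norm d)\<^sup>2 \<le> lambda_min (hess F h xbar) * (norm d)\<^sup>2"
      by (intro mult_right_mono lam_le) simp
    moreover have "e * (norm d)\<^sup>2 \<le> (1 - \<omega>) * lam * (norm d)\<^sup>2" using e by (intro mult_right_mono) auto
    ultimately show "a * (norm d)\<^sup>2 \<le> d \<bullet> (hess F h y *v d)"
      using pert lambda_min_symmetric(2)[OF hess_sym, of h xbar d]
      by (simp add: a_def abs_le_iff algebra_simps)
    have "lambda_max (hess F h xbar) * (norm d)\<^sup>2 \<le> Lam * (norm d)\<^sup>2"
      by (intro mult_right_mono Lam_ge) simp
    moreover have "e * (norm d)\<^sup>2 \<le> (Lam / \<omega> - Lam) * (norm d)\<^sup>2" using e by (intro mult_right_mono) auto
    ultimately show "d \<bullet> (hess F h y *v d) \<le> b * (norm d)\<^sup>2"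
      using pert lambda_max_symmetric[OF hess_sym, of d h xbar]
      by (simp add: b_def abs_le_iff algebra_simps)
  next
    show "norm (hess F h z - hess F h y) \<le> e" if "y \<in> N" "z \<in> N" for y z h
      using near[OF that(1), of h] near[OF that(2), of h]
        norm_triangle_ineq4[of "hess F h z - hess F h xbar" "hess F h y - hess F h xbar"] by simp
  qed

  \<comment> \<open>The tolerance \<open>a * R / 8\<close> will bound the first Newton step by
    \<open>R / 8\<close>.\<close>
  obtain \<rho>0 where \<rho>0: "0 < \<rho>0"
    "\<And>y h. dist y xbar < \<rho>0 \<Longrightarrow> norm (grad F h y - grad F h xbar) < a * R / 8"
    using eventually_grad_near[of "a * R / 8" xbar] a_pos R(1) by (auto simp: eventually_nhds_metric)
  define \<rho> where "\<rho> = min \<rho>0 (R / 4)"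
  define r where "r = R / 2"
  have \<rho>: "0 < \<rho>" "\<rho> \<le> R / 4" "\<rho> \<le> \<rho>0" using \<rho>0 R by (auto simp: \<rho>_def)
  \<comment> \<open>Such a ball stays within \<open>3 * R / 4\<close> of \<open>xbar\<close>, so a
    point of \<open>N\<close> at distance \<open>7 * R / 8\<close> witnesses strictness.\<close>
  have proper: "ball c t \<subset> N" if "dist c xbar < R / 4" "t \<le> R / 2" for c t
  proof
    show "ball c t \<subseteq> N"
    proof
      fix y assume "y \<in> ball c t"
      then show "y \<in> N" using that dist_triangle[of xbar y c] R(1) by (simp add: N_def dist_commute)
    qed
    obtain u :: "real^'n" where u: "norm u = 1" by (metis vector_choose_size zero_le_one)
    let ?p = "xbar + (7 * R / 8) *\<^sub>R u"
    have p: "dist xbar ?p = 7 * R / 8" using u R(1) by (simp add: dist_norm)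
    then have "?p \<in> N" using R(1) by (simp add: N_def)
    moreover have "?p \<notin> ball c t"
      using p that dist_triangle[of xbar ?p c] R(1) by (simp add: dist_commute)
    ultimately show "ball c t \<noteq> N" by blast
  qed

  define s where "s k = newton_direction F (x k)" for k

  have params: "valid_params P" using run by (simp add: front_descent_run_def)

  have main: "(\<forall>k\<ge>K.
          (\<forall>h. hessian_shift \<kappa> (hess F h (x k)) = 0) \<and>
          modified_newton_direction \<kappa> F (x k) = newton_direction F (x k) \<and>
          refinement_direction F P vD k (x k) = modified_newton_direction \<kappa> F (x k) \<and>
          accept_direction F P (x k) (modified_newton_direction \<kappa> F (x k)) \<and>
          (theta F UNIV (x k) < 0 \<longrightarrow> refinement_step F P vD k (x k) = 1) \<and>
          x k \<in> ball (x K) r \<and> ball (x K) r \<subset> N) \<and>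
       (\<exists>xstar \<in> ball (x K) r.
          local_Pareto_optimal F xstar \<and>
          converges_superlinearly x xstar \<and>
          ((\<forall>h. \<exists>C. C-lipschitz_on N (hess F h)) \<longrightarrow> converges_quadratically x xstar))"
    if K: "x K \<in> ball xbar \<rho>" and refining: "\<forall>k\<ge>K. x (Suc k) = refinement_point F P vD k (x k)" for K
  proof -

    \<comment> \<open>Length of the first Newton step\<close>
    have xK: "dist (x K) xbar < \<rho>" using K by (simp add: dist_commute)
    then have "x K \<in> N" using \<rho> R(1) by (simp add: N_def dist_commute)
    have "norm (s K) \<le> R / 8"
    proof -
      have "norm (steepest_direction F UNIV (x K)) \<le> a * R / 8"
        unfolding steepest_direction_UNIV_eq
      proof (rule norm_steepest_le)
        fix d
        \<comment> \<open>This slope is nonnegative since \<open>xbar\<close> is critical, and the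
          gradient of the same index at \<open>x K\<close> is close by.\<close>
        obtain h where h: "max_slope F xbar d = grad F h xbar \<bullet> d"
          using max_linear_attained[of "\<lambda>h. grad F h xbar" d] by (auto simp: max_slope_eq)
        have "\<bar>(grad F h (x K) - grad F h xbar) \<bullet> d\<bar> \<le> a * R / 8 * norm d"
          using \<rho>0(2)[of "x K" h] xK \<rho>
          by (intro order_trans[OF Cauchy_Schwarz_ineq2] mult_right_mono) auto
        then have "- (a * R / 8 * norm d) \<le> grad F h (x K) \<bullet> d"
          using local_Pareto_imp_critical[OF pareto, of d] h unfolding inner_diff_left by linarith
        also have "\<dots> \<le> max_linear (\<lambda>h. grad F h (x K)) d" by (rule max_linear_ge)
        finally show "- (a * R / 8 * norm d) \<le> max_linear (\<lambda>h. grad F h (x K)) d" .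
      qed (use a_pos R(1) in simp)
      then have "a * norm (s K) \<le> a * (R / 8)" using norm_newton_le[OF \<open>x K \<in> N\<close>] by (simp add: s_def)
      then show ?thesis using a_pos by simp
    qed
    \<comment> \<open>The budget is \<open>R / 4\<close> for the start and twice
      \<open>R / 8\<close> for the remaining path, below \<open>R\<close> in total.\<close>
    then have N_dist: "y \<in> N" if "dist y (x K) \<le> 2 * norm (s K)" for y
      using that dist_triangle[of xbar y "x K"] xK \<rho> R(1) by (simp add: N_def dist_commute)

    \<comment> \<open>One step of the sequence\<close>
    have newton_step: "x (Suc k) = x k + s k" if "k \<ge> K" "x k \<in> N" "x k + s k \<in> N" for k
      using refining tentative that params alpha0 sigma gamma e(3)
        refinement_newton(3)[OF that(2) \<Gamma>1 \<Gamma>2, of k vD] by (simp add: s_def modified_newton_eq)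
    \<comment> \<open>The bound \<open>c\<close> stays free: \<open>e\<close> gives halving,
      \<open>c * a\<close> the superlinear rate and \<open>D * norm (s k)\<close> the quadratic
      one.\<close>
    have contraction: "a * norm (s (Suc k)) \<le> c * norm (s k)"
      if "k \<ge> K" "x k \<in> N" "x k + s k \<in> N"
        "\<And>h t. 0 \<le> t \<Longrightarrow> t \<le> 1 \<Longrightarrow> norm (hess F h (x k + t *\<^sub>R s k) - hess F h (x k)) \<le> c" for k c
      using norm_newton_le[OF that(3)] steepest_after_newton_step[OF that(2), of c] that(4) newton_step[OF that(1-3)]
      by (simp add: s_def)
    have variation: "norm (hess F h (x k + t *\<^sub>R s k) - hess F h (x k)) \<le> e"
      if "x k \<in> N" "x k + s k \<in> N" "0 \<le> t" "t \<le> 1" for k h t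
      using segment_in_N[OF that] that(1) by (rule hess_variation[rotated])

    have halving: "norm (s (Suc k)) \<le> norm (s k) / 2"
      if "k \<ge> K" "x k \<in> N" "x k + s k \<in> N" for k
    proof -
      have "a * norm (s (Suc k)) \<le> e * norm (s k)"
        using that by (intro contraction variation) auto
      also have "\<dots> \<le> a / 2 * norm (s k)" using e by (intro mult_right_mono) auto
      finally have "a * norm (s (Suc k)) \<le> a * (norm (s k) / 2)" by simp
      then show ?thesis using a_pos by simp
    qed
    \<comment> \<open>The invariant alone yields the memberships that \<open>halving\<close> needs,
      so the induction below is not circular.\<close>
    have remaining: "x k \<in> N \<and> x k + s k \<in> N"
      if "dist (x k) (x K) + 2 * norm (s k) \<le> 2 * norm (s K)" for k
    proof
      show "x k \<in> N" using that norm_ge_zero[of "s k"] by (intro N_dist) linarith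
      have "dist (x k + s k) (x K) \<le> norm (s k) + dist (x k) (x K)"
        using dist_triangle[of "x k + s k" "x K" "x k"] by (simp add: dist_norm)
      then show "x k + s k \<in> N" using that norm_ge_zero[of "s k"] by (intro N_dist) linarith
    qed

    \<comment> \<open>Confinement, convergence and criticality of the limit\<close>
    have invariant: "dist (x k) (x K) + 2 * norm (s k) \<le> 2 * norm (s K)" if "k \<ge> K" for k
      using that
    proof (induction k rule: dec_induct)
      case (step k)
      have inN: "x k \<in> N" "x k + s k \<in> N" using remaining[OF step.IH] by auto
      have "norm (s (Suc k)) \<le> norm (s k) / 2" using halving \<open>K \<le> k\<close> inN by blast
      moreover have "dist (x (Suc k)) (x K) \<le> norm (s k) + dist (x k) (x K)"
        using dist_triangle[of "x (Suc k)" "x K" "x k"] newton_step[OF \<open>K \<le> k\<close> inN]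
        by (simp add: dist_norm)
      ultimately show ?case using step.IH by linarith
    qed simp
    have inN: "x k \<in> N" "x k + s k \<in> N" if "k \<ge> K" for k
      using remaining[OF invariant[OF that]] by auto
    have x_Suc: "x (Suc k) = x k + s k" if "k \<ge> K" for k using newton_step inN that by blast
    then have dist_step: "dist (x (Suc k)) (x k) = norm (s k)" if "k \<ge> K" for k
      using that by (simp add: dist_norm)
    obtain l where l: "x \<longlonglongrightarrow> l" and err: "\<And>k. k \<ge> K \<Longrightarrow> dist (x k) l \<le> 2 * dist (x (Suc k)) (x k)"
      using halving_steps_converge[of K x] halving inN dist_step by auto
    have err_ev: "eventually (\<lambda>k. dist (x k) l \<le> 2 * dist (x (Suc k)) (x k)) sequentially"
      using err by (auto simp: eventually_sequentially)
    have l_dist: "dist l (x K) \<le> 2 * norm (s K)" using err[of K] dist_step[of K] by (simp add: dist_commute)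
    then have "l \<in> N" by (rule N_dist)
    have s_lim: "(\<lambda>k. norm (s k)) \<longlonglongrightarrow> 0"
    proof -
      have "(\<lambda>k. dist (x (Suc k)) (x k)) \<longlonglongrightarrow> dist l l"
        by (intro tendsto_dist l LIMSEQ_Suc)
      moreover have "eventually (\<lambda>k. dist (x (Suc k)) (x k) = norm (s k)) sequentially"
        using dist_step by (auto simp: eventually_sequentially)
      ultimately show ?thesis by (simp add: Lim_transform_eventually)
    qed
    have Pareto: "local_Pareto_optimal F l"
    proof (rule critical_imp_local_Pareto[OF \<open>l \<in> N\<close>])
      fix d
      show "0 \<le> max_slope F l d"
      proof (rule critical_limit)
        show "(\<lambda>k. x (Suc k)) \<longlonglongrightarrow> l" by (rule LIMSEQ_Suc[OF l])
        show "(\<lambda>k. e * norm (s k)) \<longlonglongrightarrow> 0" using tendsto_mult_left[OF s_lim, of e] by simp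
        have "- (e * norm (s k) * norm d) \<le> max_slope F (x (Suc k)) d" if "k \<ge> K" for k
          using slope_after_newton_step[of "x k" e d] variation[of k] inN[OF that] x_Suc[OF that]
          by (simp add: s_def)
        then show "eventually (\<lambda>k. - (e * norm (s k) * norm d) \<le> max_slope F (x (Suc k)) d) sequentially"
          by (auto simp: eventually_sequentially)
      qed
    qed

    \<comment> \<open>Superlinear rate from continuity of the Hessians at the limit\<close>
    have superlinear: "converges_superlinearly x l"
    proof (rule converges_superlinearly_stepsI[OF l err_ev])
      fix c :: real assume "c > 0"
      then obtain \<eta> where \<eta>: "\<eta> > 0" "\<And>y h. dist y l < \<eta> \<Longrightarrow> norm (hess F h y - hess F h l) < c * a / 2"
        using eventually_hess_near[of "c * a / 2" l] a_pos by (auto simp: eventually_nhds_metric)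
      have "eventually (\<lambda>k. dist (x k) l < \<eta>) sequentially" using l \<eta>(1) by (rule tendstoD)
      moreover have "eventually (\<lambda>k. dist (x (Suc k)) l < \<eta>) sequentially"
        using LIMSEQ_Suc[OF l] \<eta>(1) by (rule tendstoD)
      ultimately show "eventually (\<lambda>k. dist (x (Suc (Suc k))) (x (Suc k)) \<le> c * dist (x (Suc k)) (x k)) sequentially"
        using eventually_ge_at_top[of K]
      proof eventually_elim
        case (elim k)
        have "norm (hess F h (x k + t *\<^sub>R s k) - hess F h (x k)) \<le> c * a" if "0 \<le> t" "t \<le> 1" for h t
        proof -
          \<comment> \<open>Both endpoints lie in a ball around \<open>l\<close>, hence so does the
            segment; two tolerances \<open>c * a / 2\<close> then add up.\<close>
          have "(1 - t) *\<^sub>R x k + t *\<^sub>R x (Suc k) \<in> ball l \<eta>"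
            using elim that by (intro convexD_alt[OF convex_ball]) (auto simp: dist_commute)
          then have "dist (x k + t *\<^sub>R s k) l < \<eta>"
            using x_Suc[OF elim(3)] by (simp add: dist_commute algebra_simps)
          from \<eta>(2)[OF this, of h] \<eta>(2)[OF elim(1), of h] show ?thesis
            using norm_triangle_ineq4[of "hess F h (x k + t *\<^sub>R s k) - hess F h l" "hess F h (x k) - hess F h l"]
            by simp
        qed
        then have "a * norm (s (Suc k)) \<le> c * a * norm (s k)"
          using inN[OF elim(3)] elim(3) by (intro contraction) auto
        then have "a * norm (s (Suc k)) \<le> a * (c * norm (s k))" by (simp add: mult_ac)
        then show ?case using a_pos elim(3) by (simp add: dist_step)
      qed
    qed

    \<comment> \<open>Quadratic rate from Lipschitz Hessians\<close>
    have quadratic: "converges_quadratically x l" if lipschitz: "\<forall>h. \<exists>C. C-lipschitz_on N (hess F h)"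
    proof -
      obtain C where C: "\<And>h. (C h)-lipschitz_on N (hess F h)" using lipschitz by metis
      \<comment> \<open>The sum serves as a Lipschitz constant common to all Hessians.\<close>
      define D where "D = (\<Sum>h\<in>UNIV. C h)"
      have C_nonneg: "0 \<le> C h" for h using C by (rule lipschitz_on_nonneg)
      then have "0 \<le> D" by (simp add: D_def sum_nonneg)
      have C_le: "C h \<le> D" for h unfolding D_def using C_nonneg by (intro member_le_sum) auto
      have "dist (x (Suc (Suc k))) (x (Suc k)) \<le> D / a * (dist (x (Suc k)) (x k))\<^sup>2" if k: "k \<ge> K" for k
      proof -
        have "norm (hess F h (x k + t *\<^sub>R s k) - hess F h (x k)) \<le> D * norm (s k)" if t: "0 \<le> t" "t \<le> 1" for h t
        proof -
          have "norm (hess F h (x k + t *\<^sub>R s k) - hess F h (x k)) \<le> C h * (t * norm (s k))"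
            using lipschitz_onD[OF C segment_in_N[OF inN[OF k] t] inN(1)[OF k], of h] t
            by (simp add: dist_norm)
          also have "\<dots> \<le> D * (1 * norm (s k))"
            using t C_le \<open>0 \<le> D\<close> by (intro mult_mono) auto
          finally show ?thesis by simp
        qed
        then have "a * norm (s (Suc k)) \<le> D * norm (s k) * norm (s k)"
          using inN[OF k] k by (intro contraction) auto
        then show ?thesis using a_pos k by (simp add: dist_step power2_eq_square field_simps)
      qed
      then show ?thesis
        using superlinear err_ev \<open>0 \<le> D\<close> a_pos
        by (intro converges_quadratically_stepsI[where C = "D / a"]) (auto simp: eventually_sequentially)
    qed

    \<comment> \<open>Collecting the claims for all \<open>k \<ge> K\<close>\<close>
    have sK: "2 * norm (s K) < r" using \<open>norm (s K) \<le> R / 8\<close> R(1) by (simp add: r_def)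
    have "l \<in> ball (x K) r" using l_dist sK by (simp add: dist_commute)
    moreover have "x k \<in> ball (x K) r" if "k \<ge> K" for k
      using invariant[OF that] norm_ge_zero[of "s k"] sK by (simp add: dist_commute del: norm_ge_zero)
    moreover have "ball (x K) r \<subset> N" using xK \<rho> by (intro proper) (auto simp: r_def)
    moreover have "hessian_shift \<kappa> (hess F h (x k)) = 0"
      "modified_newton_direction \<kappa> F (x k) = newton_direction F (x k)"
      "refinement_direction F P vD k (x k) = newton_direction F (x k)"
      "accept_direction F P (x k) (newton_direction F (x k))"
      "theta F UNIV (x k) < 0 \<Longrightarrow> refinement_step F P vD k (x k) = 1" if k: "k \<ge> K" for k h
      using inN[OF k] hessian_shift_eq_0 modified_newton_eq accept_newton[OF inN(1)[OF k] \<Gamma>1 \<Gamma>2]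
        refinement_newton(1,2)[OF inN(1)[OF k] \<Gamma>1 \<Gamma>2, of k vD]
        tentative params alpha0 sigma gamma e(3) by (auto simp: s_def)
    ultimately show ?thesis using Pareto superlinear quadratic by auto
  qed

  show ?thesis
  proof (intro exI conjI)
    show "open N" "xbar \<in> N" using R(1) by (simp_all add: N_def)
    show "0 < \<rho>" by fact
    show "\<rho> \<le> r" using \<rho> R(1) by (simp add: r_def)
    show "ball xbar \<rho> \<subset> N" using \<rho> R(1) by (intro proper) auto
  qed (use main in blast)
qed

end
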